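(* Fix an integer $m\ge2$ and let $Z$ be a fat point scheme in $\mathbb{P}^1\times\mathbb{P}^1$ all of whose points have multiplicity $m$. Then $Z$ is ACM if and only if $\mathrm{Supp}(Z)$ is a complete intersection.
   Context: $\mathbf{k}$ algebraically closed, $R=\mathbf{k}[x_0,x_1,y_0,y_1]$ bigraded with $\deg x_i=(1,0)$, $\deg y_i=(0,1)$; a point $[a_0:a_1]\times[b_0:b_1]$ has ideal $(a_1x_0-a_0x_1,b_1y_0-b_0y_1)$; a fat point scheme $Z=\{(P_1;m_1),\dots,(P_s;m_s)\}$ has ideal $I_Z=\bigcap\wp_{P_i}^{m_i}$ and is ACM if $R/I_Z$ is Cohen–Macaulay. A reduced set of points $\mathbb{X}$ is a complete intersection if its ideal is $I_{\mathbb{X}}=(F,G)$ with $F$ bihomogeneous of degree $(a,0)$ and $G$ bihomogeneous of degree $(0,b)$ for some $a,b$ (equivalently, $\mathbb{X}=\{R\times Q : R\in\pi_1(\mathbb{X}),\ Q\in\pi_2(\mathbb{X})\}$). *)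

theory Defs
  imports "HOL-Library.Poly_Mapping" "HOL-Library.Extended_Nat"
          "HOL-Computational_Algebra.Polynomial"
begin

datatype var = X0 | X1 | Y0 | Y1

text \<open>Polynomials in the four variables: finitely supported maps from monomials
  (finitely supported exponent vectors) to coefficients.\<close>
type_synonym 'k bpoly = "(var \<Rightarrow>\<^sub>0 nat) \<Rightarrow>\<^sub>0 'k"

definition Var :: "var \<Rightarrow> 'k::comm_ring_1 bpoly" where
  "Var v = Poly_Mapping.single (Poly_Mapping.single v 1) 1"

definition Const :: "'k::comm_ring_1 \<Rightarrow> 'k bpoly" where
  "Const c = Poly_Mapping.single 0 c"

definition bihomogeneous :: "nat \<Rightarrow> nat \<Rightarrow> 'k::comm_ring_1 bpoly \<Rightarrow> bool" where
  "bihomogeneous a b F \<longleftrightarrow>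
     (\<forall>\<mu>\<in>Poly_Mapping.keys F.
        Poly_Mapping.lookup \<mu> X0 + Poly_Mapping.lookup \<mu> X1 = a \<and> Poly_Mapping.lookup \<mu> Y0 + Poly_Mapping.lookup \<mu> Y1 = b)"

definition is_ideal :: "'a::comm_ring_1 set \<Rightarrow> bool" where
  "is_ideal I \<longleftrightarrow> 0 \<in> I \<and> (\<forall>a\<in>I. \<forall>b\<in>I. a + b \<in> I) \<and> (\<forall>r. \<forall>a\<in>I. r * a \<in> I)"

definition ideal_gen :: "'a::comm_ring_1 set \<Rightarrow> 'a set" where
  "ideal_gen S = \<Inter>{I. is_ideal I \<and> S \<subseteq> I}"

definition ideal_sum :: "'a::comm_ring_1 set \<Rightarrow> 'a set \<Rightarrow> 'a set" where
  "ideal_sum I J = ideal_gen (I \<union> J)"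

definition ideal_prod :: "'a::comm_ring_1 set \<Rightarrow> 'a set \<Rightarrow> 'a set" where
  "ideal_prod I J = ideal_gen {a * b | a b. a \<in> I \<and> b \<in> J}"

fun ideal_pow :: "'a::comm_ring_1 set \<Rightarrow> nat \<Rightarrow> 'a set" where
  "ideal_pow I 0 = UNIV"
| "ideal_pow I (Suc n) = ideal_prod I (ideal_pow I n)"

definition prime_ideal :: "'a::comm_ring_1 set \<Rightarrow> bool" where
  "prime_ideal P \<longleftrightarrow> is_ideal P \<and> P \<noteq> UNIV \<and> (\<forall>a b. a * b \<in> P \<longrightarrow> a \<in> P \<or> b \<in> P)"

definition krull_dim_quot :: "'a::comm_ring_1 set \<Rightarrow> enat" where
  "krull_dim_quot I = Sup {enat n | n. \<exists>P :: nat \<Rightarrow> 'a set.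
      (\<forall>i\<le>n. prime_ideal (P i) \<and> I \<subseteq> P i) \<and> (\<forall>i<n. P i \<subset> P (Suc i))}"

definition regular_seq :: "'a::comm_ring_1 set \<Rightarrow> 'a list \<Rightarrow> bool" where
  "regular_seq I fs \<longleftrightarrow>
     (\<forall>i<length fs. \<forall>g. fs ! i * g \<in> ideal_sum I (ideal_gen (set (take i fs)))
                        \<longrightarrow> g \<in> ideal_sum I (ideal_gen (set (take i fs))))
     \<and> ideal_sum I (ideal_gen (set fs)) \<noteq> UNIV"

definition irrelevant_ideal :: "'k::comm_ring_1 bpoly set" where
  "irrelevant_ideal = ideal_gen (range Var)"

definition depth_quot :: "'k::comm_ring_1 bpoly set \<Rightarrow> enat" where
  "depth_quot I = Sup {enat (length fs) | fs. set fs \<subseteq> irrelevant_ideal \<and> regular_seq I fs}"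

text \<open>For the (homogeneous) ideal I, R/I is Cohen--Macaulay iff depth = dimension.\<close>
definition ACM_ideal :: "'k::comm_ring_1 bpoly set \<Rightarrow> bool" where
  "ACM_ideal I \<longleftrightarrow> depth_quot I = krull_dim_quot I"

text \<open>A point [a0:a1] x [b0:b1] is represented by ((a0,a1),(b0,b1)).\<close>
type_synonym 'k point = "('k \<times> 'k) \<times> ('k \<times> 'k)"

definition valid_point :: "'k::field point \<Rightarrow> bool" where
  "valid_point P \<longleftrightarrow> fst P \<noteq> (0, 0) \<and> snd P \<noteq> (0, 0)"

definition point_ideal :: "'k::field point \<Rightarrow> 'k bpoly set" where
  "point_ideal P = (case P of ((a0, a1), (b0, b1)) \<Rightarrow>
     ideal_gen {Const a1 * Var X0 - Const a0 * Var X1, Const b1 * Var Y0 - Const b0 * Var Y1})"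

definition fat_ideal :: "nat \<Rightarrow> 'k::field point set \<Rightarrow> 'k bpoly set" where
  "fat_ideal m S = (\<Inter>P\<in>S. ideal_pow (point_ideal P) m)"

definition points_ideal :: "'k::field point set \<Rightarrow> 'k bpoly set" where
  "points_ideal S = (\<Inter>P\<in>S. point_ideal P)"

definition complete_intersection :: "'k::field point set \<Rightarrow> bool" where
  "complete_intersection S \<longleftrightarrow>
     (\<exists>a b F G. bihomogeneous a 0 F \<and> bihomogeneous 0 b G \<and> points_ideal S = ideal_gen {F, G})"

end

theory Submission
  imports Defs
begin

text \<open>All quotients have dimension 2, so the question is whether the depth is 2. Modulo the fat ideal
  any three polynomials are algebraically dependent, by counting monomials, and a relation of least
  order among the members of a regular sequence, or along a chain of primes, is contradictory; so both
  invariants are at most 2. Over a grid \<open>A \<times> B\<close> the fat ideal is \<open>(F, G)\<^sup>m\<close>, with \<open>F\<close> and \<open>G\<close> the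
  products of the linear forms of the columns and rows, and a general linear form in \<open>x\<close> followed by
  one in \<open>y\<close> is a regular sequence. Off a grid, let \<open>l\<close> be a general linear form in \<open>x\<close>, call a row
  full if it meets all columns, and let \<open>w\<close> be the number of columns whose points all lie in full
  rows. Every form of the ideal whose \<open>y\<close>-degree is the number of full rows has \<open>x\<close>-degree at least
  \<open>m |A| - w\<close>, whereas locally at each row of the support the degree \<open>m |A| - w - 1\<close> already suffices
  modulo \<open>l\<close>, because \<open>m \<ge> 2\<close>. The discrepancy is a socle element modulo \<open>l\<close>, and exchanging \<open>l\<close>
  for the first member of a regular sequence shows that the depth is at most 1.\<close>

section \<open>Ideals and regular elements\<close>

lemma module_mult: "module ((*) :: 'a::comm_ring_1 \<Rightarrow> 'a \<Rightarrow> 'a)"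
  by standard (simp_all add: algebra_simps)

lemma is_ideal_iff_subspace: "is_ideal I \<longleftrightarrow> module.subspace (*) I"
  by (auto simp: is_ideal_def module.subspace_def[OF module_mult])

lemma ideal_gen_eq_span: "ideal_gen S = module.span (*) S"
  by (simp add: ideal_gen_def module.span_def[OF module_mult] hull_def is_ideal_iff_subspace)

lemmas ideal_zero = module.subspace_0[OF module_mult, folded is_ideal_iff_subspace]
  and ideal_add = module.subspace_add[OF module_mult, folded is_ideal_iff_subspace]
  and ideal_mult = module.subspace_scale[OF module_mult, folded is_ideal_iff_subspace]
  and ideal_uminus = module.subspace_neg[OF module_mult, folded is_ideal_iff_subspace]
  and ideal_diff = module.subspace_diff[OF module_mult, folded is_ideal_iff_subspace]
  and is_ideal_INT = module.subspace_Int[OF module_mult, folded is_ideal_iff_subspace]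
  and is_ideal_zero = module.subspace_single_0[OF module_mult, folded is_ideal_iff_subspace]
  and is_ideal_ideal_gen =
    module.subspace_span[OF module_mult, folded is_ideal_iff_subspace ideal_gen_eq_span]
  and ideal_gen_base = module.span_base[OF module_mult, folded ideal_gen_eq_span]
  and ideal_gen_superset = module.span_superset[OF module_mult, folded ideal_gen_eq_span]
  and ideal_gen_least =
    module.span_minimal[OF module_mult, folded is_ideal_iff_subspace ideal_gen_eq_span]
  and ideal_gen_mono = module.span_mono[OF module_mult, folded ideal_gen_eq_span]
  and ideal_gen_empty = module.span_empty[OF module_mult, folded ideal_gen_eq_span]
  and ideal_gen_ideal =
    module.span_eq_iff[OF module_mult, folded is_ideal_iff_subspace ideal_gen_eq_span, THEN iffD2]
  and ideal_gen_eq_iff = module.span_eq[OF module_mult, folded ideal_gen_eq_span]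
  and mem_ideal_gen_insert_iff = module.span_breakdown_eq[OF module_mult, folded ideal_gen_eq_span]

lemma ideal_mult_right: "is_ideal I \<Longrightarrow> a \<in> I \<Longrightarrow> a * r \<in> I"
  using ideal_mult[of I a r] by (simp add: mult.commute)

lemma ideal_diff_iff: "is_ideal I \<Longrightarrow> a - b \<in> I \<Longrightarrow> a \<in> I \<longleftrightarrow> b \<in> I"
  using ideal_add[of I "a - b" b] ideal_diff[of I a "a - b"] by auto

lemma ideal_eq_UNIV: "is_ideal I \<Longrightarrow> 1 \<in> I \<Longrightarrow> I = UNIV"
  using ideal_mult[of I 1] by auto

lemma is_ideal_colon: "is_ideal J \<Longrightarrow> is_ideal {a. a * z \<in> J}"
  by (auto simp: is_ideal_def algebra_simps)

lemma prod_mem_ideal: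
  assumes "is_ideal I" "finite A" "i \<in> A" "f i \<in> I"
  shows "(\<Prod>i\<in>A. f i) \<in> I"
  using assms by (auto simp: prod.remove intro: ideal_mult_right)

lemma ideal_gen_Un_ideal_gen: "ideal_gen (ideal_gen S \<union> T) = ideal_gen (S \<union> T)"
  unfolding ideal_gen_eq_iff
  using ideal_gen_mono[of S "S \<union> T"] ideal_gen_superset[of "S \<union> T"]
    ideal_gen_superset[of S] ideal_gen_superset[of "ideal_gen S \<union> T"]
  by blast

lemma ideal_sum_ideal_gen: "ideal_sum I (ideal_gen S) = ideal_gen (I \<union> S)"
  unfolding ideal_sum_def using ideal_gen_Un_ideal_gen[of S I] by (simp add: Un_commute)

definition adjoin :: "'a::comm_ring_1 set \<Rightarrow> 'a \<Rightarrow> 'a set" where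
  "adjoin J f = ideal_gen (insert f J)"

lemma is_ideal_adjoin: "is_ideal (adjoin J f)"
  by (simp add: adjoin_def is_ideal_ideal_gen)

lemma adjoin_superset: "J \<subseteq> adjoin J f"
  using ideal_gen_superset unfolding adjoin_def by blast

lemma adjoin_self: "f \<in> adjoin J f"
  by (simp add: adjoin_def ideal_gen_base)

lemma adjoin_one: "adjoin J 1 = UNIV"
  using is_ideal_adjoin adjoin_self by (rule ideal_eq_UNIV)

lemma adjoin_least: "is_ideal I \<Longrightarrow> J \<subseteq> I \<Longrightarrow> f \<in> I \<Longrightarrow> adjoin J f \<subseteq> I"
  unfolding adjoin_def by (intro ideal_gen_least) auto

lemma mem_adjoin_iff: "is_ideal J \<Longrightarrow> x \<in> adjoin J f \<longleftrightarrow> (\<exists>r. x - f * r \<in> J)"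
  unfolding adjoin_def mem_ideal_gen_insert_iff by (simp add: ideal_gen_ideal mult.commute)

lemma adjoinI: "j \<in> J \<Longrightarrow> j + f * r \<in> adjoin J f"
  using adjoin_superset adjoin_self by (blast intro: ideal_add ideal_mult_right is_ideal_adjoin)

lemma mem_adjoin_zero_iff: "x \<in> adjoin {0} f \<longleftrightarrow> f dvd x"
  by (auto simp: mem_adjoin_iff is_ideal_zero dvd_def)

lemma adjoin_ideal_gen: "adjoin (ideal_gen S) f = ideal_gen (insert f S)"
  unfolding adjoin_def using ideal_gen_Un_ideal_gen[of S "{f}"] by simp

lemma adjoin_commute: "adjoin (adjoin J f) g = adjoin (adjoin J g) f"
  unfolding adjoin_def[of J] adjoin_ideal_gen by (simp add: insert_commute)

definition regular_mod :: "'a::comm_ring_1 set \<Rightarrow> 'a \<Rightarrow> bool" where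
  "regular_mod J f \<longleftrightarrow> (\<forall>g. f * g \<in> J \<longrightarrow> g \<in> J)"

lemma regular_modD: "regular_mod J f \<Longrightarrow> f * g \<in> J \<Longrightarrow> g \<in> J"
  by (simp add: regular_mod_def)

lemma regular_mod_one: "regular_mod J 1"
  by (simp add: regular_mod_def)

lemma regular_mod_mult: "regular_mod J f \<Longrightarrow> regular_mod J g \<Longrightarrow> regular_mod J (f * g)"
  unfolding regular_mod_def mult.assoc by blast

lemma regular_mod_power: "regular_mod J f \<Longrightarrow> regular_mod J (f ^ n)"
  by (induction n) (auto intro: regular_mod_mult regular_mod_one)

lemma regular_mod_prod: "(\<And>i. i \<in> A \<Longrightarrow> regular_mod J (f i)) \<Longrightarrow> regular_mod J (\<Prod>i\<in>A. f i)"
  by (induction A rule: infinite_finite_induct) (auto intro: regular_mod_mult regular_mod_one)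

lemma regular_mod_INT: "(\<And>i. i \<in> A \<Longrightarrow> regular_mod (J i) f) \<Longrightarrow> regular_mod (\<Inter>i\<in>A. J i) f"
  by (auto simp: regular_mod_def)

lemma prime_ideal_is_ideal: "prime_ideal P \<Longrightarrow> is_ideal P"
  by (simp add: prime_ideal_def)

lemma regular_mod_prime: "prime_ideal P \<Longrightarrow> f \<notin> P \<Longrightarrow> regular_mod P f"
  by (auto simp: regular_mod_def prime_ideal_def)

lemma prime_ideal_prod:
  assumes "prime_ideal P" "finite A" "(\<Prod>i\<in>A. f i) \<in> P"
  shows "\<exists>i\<in>A. f i \<in> P"
proof (rule ccontr)
  assume "\<not> (\<exists>i\<in>A. f i \<in> P)"
  then have "regular_mod P (\<Prod>i\<in>A. f i)"
    using assms(1) by (intro regular_mod_prod regular_mod_prime) auto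
  then have "1 \<in> P" using assms(3) by (auto dest: regular_modD[where g = 1])
  then show False using assms(1) ideal_eq_UNIV by (auto simp: prime_ideal_def)
qed

lemma prime_ideal_power: "prime_ideal P \<Longrightarrow> f ^ n \<in> P \<Longrightarrow> f \<in> P"
  using prime_ideal_prod[of P "{..<n}" "\<lambda>_. f"] by auto

lemma regular_mod_adjoin_swap:
  assumes J: "is_ideal J" and f: "regular_mod J f" and g: "regular_mod (adjoin J f) g"
  shows "regular_mod (adjoin J g) f"
  unfolding regular_mod_def
proof (intro allI impI)
  fix a assume "f * a \<in> adjoin J g"
  then obtain b where fa: "f * a - g * b \<in> J" using mem_adjoin_iff[OF J] by blast
  have "g * b = - (f * a - g * b) + f * a" by simp
  then have "g * b \<in> adjoin J f" using fa ideal_uminus[OF J] by (metis adjoinI)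
  then have "b \<in> adjoin J f" by (rule regular_modD[OF g])
  then obtain c where b: "b - f * c \<in> J" using mem_adjoin_iff[OF J] by blast
  have "(f * a - g * b) + g * (b - f * c) \<in> J" using fa b J by (simp add: ideal_add ideal_mult)
  then have "f * (a - g * c) \<in> J" by (simp add: algebra_simps)
  then have "a - g * c \<in> J" by (rule regular_modD[OF f])
  then show "a \<in> adjoin J g" using mem_adjoin_iff[OF J] by blast
qed

lemma regular_mod_adjoin_power:
  assumes J: "is_ideal J" and v: "regular_mod J v" and w: "regular_mod (adjoin J v) w"
  shows "regular_mod (adjoin J (v ^ n)) w"
proof (induction n)
  case 0
  then show ?case by (simp add: adjoin_one regular_mod_def)
next
  case (Suc n)
  show ?case unfolding regular_mod_def
  proof (intro allI impI)
    fix f assume "w * f \<in> adjoin J (v ^ Suc n)"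
    then obtain h where wf: "w * f - v ^ Suc n * h \<in> J" using mem_adjoin_iff[OF J] by blast
    then have "w * f \<in> adjoin J v"
      using mem_adjoin_iff[OF J] by (metis mult.assoc power_Suc)
    then have "f \<in> adjoin J v" by (rule regular_modD[OF w])
    then obtain f' where f: "f - v * f' \<in> J" using mem_adjoin_iff[OF J] by blast
    have "(w * f - v ^ Suc n * h) - w * (f - v * f') \<in> J"
      using wf f J by (simp only: ideal_diff ideal_mult)
    then have "v * (w * f' - v ^ n * h) \<in> J" by (simp add: algebra_simps)
    then have "w * f' - v ^ n * h \<in> J" by (rule regular_modD[OF v])
    then have "w * f' \<in> adjoin J (v ^ n)" using mem_adjoin_iff[OF J] by blast
    then have "f' \<in> adjoin J (v ^ n)" by (rule regular_modD[OF Suc])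
    then obtain r where f': "f' - v ^ n * r \<in> J" using mem_adjoin_iff[OF J] by blast
    have "(f - v * f') + v * (f' - v ^ n * r) \<in> J" using f f' J by (simp only: ideal_add ideal_mult)
    then have "f - v ^ Suc n * r \<in> J" by (simp add: algebra_simps)
    then show "f \<in> adjoin J (v ^ Suc n)" using mem_adjoin_iff[OF J] by blast
  qed
qed

lemma mem_adjoin_mult:
  assumes J: "is_ideal J" and w: "regular_mod (adjoin J v) w"
    and f: "f \<in> adjoin J v" "f \<in> adjoin J w"
  shows "f \<in> adjoin J (v * w)"
proof -
  obtain y where y: "f - w * y \<in> J" using f(2) mem_adjoin_iff[OF J] by blast
  then have "f - w * y \<in> adjoin J v" using adjoin_superset by blast
  then have "w * y \<in> adjoin J v" using ideal_diff_iff[OF is_ideal_adjoin] f(1) by blast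
  then have "y \<in> adjoin J v" by (rule regular_modD[OF w])
  then obtain h where h: "y - v * h \<in> J" using mem_adjoin_iff[OF J] by blast
  have "(f - w * y) + w * (y - v * h) \<in> J" using y h J by (simp only: ideal_add ideal_mult)
  then have "f - (v * w) * h \<in> J" by (simp add: algebra_simps)
  then show ?thesis using mem_adjoin_iff[OF J] by blast
qed

lemma mem_adjoin_prod_power:
  assumes J: "is_ideal J" and "finite A"
    and regular: "\<And>r. r \<in> A \<Longrightarrow> regular_mod J (v r)"
    and pairs: "\<And>r s. r \<in> A \<Longrightarrow> s \<in> A \<Longrightarrow> r \<noteq> s \<Longrightarrow> regular_mod (adjoin J (v s)) (v r)"
    and f: "\<And>r. r \<in> A \<Longrightarrow> f \<in> adjoin J (v r ^ e r)"
  shows "f \<in> adjoin J (\<Prod>r\<in>A. v r ^ e r)"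
  using \<open>finite A\<close> regular pairs f
proof (induction A rule: finite_induct)
  case empty
  then show ?case by (simp add: adjoin_one)
next
  case (insert s A)
  have "regular_mod (adjoin J (v s ^ e s)) (\<Prod>r\<in>A. v r ^ e r)"
    using insert by (intro regular_mod_prod regular_mod_power regular_mod_adjoin_power J) auto
  then show ?case
    using insert mem_adjoin_mult[OF J, of "v s ^ e s" "\<Prod>r\<in>A. v r ^ e r" f] by auto
qed

section \<open>Regular sequences and socles\<close>

lemma regular_seq_Nil: "is_ideal I \<Longrightarrow> regular_seq I [] \<longleftrightarrow> I \<noteq> UNIV"
  by (simp add: regular_seq_def ideal_sum_ideal_gen ideal_gen_ideal)

lemma regular_seq_Cons:
  assumes "is_ideal I"
  shows "regular_seq I (f # fs) \<longleftrightarrow> regular_mod I f \<and> regular_seq (adjoin I f) fs"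
proof -
  have "ideal_gen (I \<union> insert f T) = ideal_gen (adjoin I f \<union> T)" for T
    using ideal_gen_Un_ideal_gen[of "insert f I" T] by (simp add: adjoin_def)
  then show ?thesis
    using assms
    by (simp add: regular_seq_def ideal_sum_ideal_gen All_less_Suc2 regular_mod_def ideal_gen_ideal)
qed

definition has_socle :: "'a::comm_ring_1 set \<Rightarrow> 'a set \<Rightarrow> bool" where
  "has_socle M J \<longleftrightarrow> (\<exists>z. z \<notin> J \<and> (\<forall>a\<in>M. a * z \<in> J))"

lemma regular_mod_not_has_socle: "regular_mod J f \<Longrightarrow> f \<in> M \<Longrightarrow> \<not> has_socle M J"
  by (auto simp: regular_mod_def has_socle_def)

lemma has_socle_exchange:
  assumes J: "is_ideal J" and f: "regular_mod J f" and g: "regular_mod J g" and M: "f \<in> M"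
    and socle: "has_socle M (adjoin J g)"
  shows "has_socle M (adjoin J f)"
proof -
  obtain z where z: "z \<notin> adjoin J g" "\<And>a. a \<in> M \<Longrightarrow> a * z \<in> adjoin J g"
    using socle by (auto simp: has_socle_def)
  obtain w where w: "f * z - g * w \<in> J" using z(2)[OF M] mem_adjoin_iff[OF J] by blast
  have "w \<notin> adjoin J f"
  proof
    assume "w \<in> adjoin J f"
    then obtain c where "w - f * c \<in> J" using mem_adjoin_iff[OF J] by blast
    then have "(f * z - g * w) + g * (w - f * c) \<in> J" using w J by (simp add: ideal_add ideal_mult)
    then have "f * (z - g * c) \<in> J" by (simp add: algebra_simps)
    then have "z - g * c \<in> J" by (rule regular_modD[OF f])
    then show False using z(1) mem_adjoin_iff[OF J] by blast
  qed
  moreover have "a * w \<in> adjoin J f" if a: "a \<in> M" for a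
  proof -
    obtain b where b: "a * z - g * b \<in> J" using z(2)[OF a] mem_adjoin_iff[OF J] by blast
    have "f * (a * z - g * b) - a * (f * z - g * w) \<in> J"
      using w b J by (simp add: ideal_diff ideal_mult)
    then have "g * (a * w - f * b) \<in> J" by (simp add: algebra_simps)
    then have "a * w - f * b \<in> J" by (rule regular_modD[OF g])
    then show ?thesis using mem_adjoin_iff[OF J] by blast
  qed
  ultimately show ?thesis by (auto simp: has_socle_def)
qed

lemma depth_quot_le_one:
  assumes I: "is_ideal I" and l: "regular_mod I l"
    and socle: "has_socle irrelevant_ideal (adjoin I l)"
  shows "depth_quot I \<le> 1"
  unfolding depth_quot_def
proof (rule Sup_least, clarify)
  fix fs assume fs: "set fs \<subseteq> irrelevant_ideal" "regular_seq I fs"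
  have "length fs \<le> 1"
  proof (rule ccontr)
    assume "\<not> length fs \<le> 1"
    then obtain f g gs where "fs = f # g # gs" by (cases fs rule: remdups_adj.cases) auto
    then have fg: "f \<in> irrelevant_ideal" "g \<in> irrelevant_ideal"
        "regular_mod I f" "regular_mod (adjoin I f) g"
      using fs by (auto simp: regular_seq_Cons I is_ideal_adjoin)
    then show False
      using has_socle_exchange[OF I fg(3) l fg(1) socle] regular_mod_not_has_socle by blast
  qed
  then show "enat (length fs) \<le> 1" by (simp add: one_enat_def)
qed

lemma depth_quot_ge_two:
  assumes "is_ideal I" "f \<in> irrelevant_ideal" "g \<in> irrelevant_ideal"
    and "regular_mod I f" "regular_mod (adjoin I f) g" "adjoin (adjoin I f) g \<noteq> UNIV"
  shows "2 \<le> depth_quot I"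
proof -
  have "regular_seq I [f, g]"
    using assms by (simp add: regular_seq_Cons regular_seq_Nil is_ideal_adjoin)
  then have "enat (length [f, g]) \<le> depth_quot I"
    unfolding depth_quot_def using assms by (intro Sup_upper CollectI exI[of _ "[f, g]"]) auto
  then show ?thesis by (simp add: numeral_eq_enat numeral_2_eq_2)
qed

lemma killed_by_power:
  fixes k :: "'a::comm_ring_1"
  shows "k ^ n * z \<in> J \<Longrightarrow> z \<notin> J \<Longrightarrow> \<exists>r. r * z \<notin> J \<and> k * (r * z) \<in> J"
proof (induction n)
  case (Suc n)
  then show ?case by (cases "k ^ n * z \<in> J") (auto simp: mult.assoc)
qed simp

lemma killed_by_prod_power:
  fixes k :: "'b \<Rightarrow> 'a::comm_ring_1"
  assumes "finite A" "(\<Prod>i\<in>A. k i ^ e i) * z \<in> J" "z \<notin> J"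
  shows "\<exists>i\<in>A. \<exists>r. r * z \<notin> J \<and> k i * (r * z) \<in> J"
  using assms
proof (induction A arbitrary: z rule: finite_induct)
  case (insert s A)
  show ?case
  proof (cases "k s ^ e s * z \<in> J")
    case True
    then show ?thesis using killed_by_power[OF _ insert.prems(2)] by blast
  next
    case False
    have "(\<Prod>i\<in>A. k i ^ e i) * (k s ^ e s * z) \<in> J" using insert by (simp add: algebra_simps)
    from insert.IH[OF this False] obtain i r
      where "i \<in> A" "r * (k s ^ e s * z) \<notin> J" "k i * (r * (k s ^ e s * z)) \<in> J" by blast
    then show ?thesis by (intro bexI[of _ i] exI[of _ "r * k s ^ e s"]) (auto simp: mult.assoc)
  qed
qed simp

section \<open>Powers of two-generated ideals\<close>

definition pair_pow :: "'a::comm_ring_1 set \<Rightarrow> 'a \<Rightarrow> 'a \<Rightarrow> nat \<Rightarrow> 'a set" where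
  "pair_pow J u v n = ideal_gen (J \<union> {u ^ k * v ^ l | k l. k + l = n})"

lemma is_ideal_pair_pow: "is_ideal (pair_pow J u v n)"
  by (simp add: pair_pow_def is_ideal_ideal_gen)

lemma pair_pow_superset: "J \<subseteq> pair_pow J u v n"
  unfolding pair_pow_def using ideal_gen_superset by blast

lemma pair_pow_least:
  assumes "is_ideal I" "J \<subseteq> I" "\<And>k l. k + l = n \<Longrightarrow> u ^ k * v ^ l \<in> I"
  shows "pair_pow J u v n \<subseteq> I"
  unfolding pair_pow_def using assms by (intro ideal_gen_least) auto

lemma pair_pow_monomial:
  assumes "n \<le> k + l" shows "u ^ k * v ^ l \<in> pair_pow J u v n"
proof -
  define k' l' where "k' = min k n" and "l' = n - k'"
  have "u ^ k' * v ^ l' \<in> pair_pow J u v n"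
    unfolding pair_pow_def k'_def l'_def by (intro ideal_gen_base UnI2 CollectI exI conjI refl) auto
  then have "u ^ k' * v ^ l' * (u ^ (k - k') * v ^ (l - l')) \<in> pair_pow J u v n"
    by (rule ideal_mult_right[OF is_ideal_pair_pow])
  moreover have "u ^ k = u ^ k' * u ^ (k - k')" "v ^ l = v ^ l' * v ^ (l - l')"
    using assms by (simp_all add: k'_def l'_def flip: power_add)
  ultimately show ?thesis by (simp add: ac_simps)
qed

lemma power_mult_mem_pair_pow: "v ^ n * h \<in> pair_pow J u v n"
  using ideal_mult_right[OF is_ideal_pair_pow pair_pow_monomial[of n 0 n u v J]] by simp

lemma adjoin_power_subset_pair_pow: "adjoin J (v ^ n) \<subseteq> pair_pow J u v n"
  using power_mult_mem_pair_pow[of v n 1]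
  by (intro adjoin_least is_ideal_pair_pow pair_pow_superset) simp

lemma pair_pow_0: "pair_pow J u v 0 = UNIV"
  using pair_pow_monomial[of 0 0 0 u v J] by (simp add: ideal_eq_UNIV is_ideal_pair_pow)

lemma pair_pow_1: "pair_pow {0} u v 1 = ideal_gen {u, v}"
proof -
  have "{u ^ k * v ^ l | k l. k + l = 1} = {u, v}"
    by (auto simp: add_is_1 intro: exI[of _ 0] exI[of _ 1])
  then have "pair_pow {0} u v 1 = ideal_gen (insert 0 {u, v})"
    by (simp add: pair_pow_def insert_commute)
  also have "\<dots> = ideal_gen {u, v}"
    unfolding ideal_gen_eq_iff by (auto intro: ideal_gen_base ideal_zero is_ideal_ideal_gen)
  finally show ?thesis .
qed

lemma pair_pow_commute: "pair_pow J u v n = pair_pow J v u n"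
proof -
  have "pair_pow J u v n \<subseteq> pair_pow J v u n" for u v
  proof (rule pair_pow_least[OF is_ideal_pair_pow pair_pow_superset])
    show "u ^ k * v ^ l \<in> pair_pow J v u n" if "k + l = n" for k l
      using pair_pow_monomial[of n l k v u J] that by (simp add: ac_simps)
  qed
  then show ?thesis by blast
qed

lemma mult_mem_pair_pow_Suc:
  assumes "f \<in> pair_pow J u v n" shows "u * f \<in> pair_pow J u v (Suc n)"
proof -
  have "pair_pow J u v n \<subseteq> {f. f * u \<in> pair_pow J u v (Suc n)}"
  proof (rule pair_pow_least)
    show "is_ideal {f. f * u \<in> pair_pow J u v (Suc n)}"
      by (rule is_ideal_colon[OF is_ideal_pair_pow])
    show "J \<subseteq> {f. f * u \<in> pair_pow J u v (Suc n)}"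
      by (auto intro: ideal_mult_right[OF is_ideal_pair_pow] subsetD[OF pair_pow_superset])
    show "u ^ k * v ^ l \<in> {f. f * u \<in> pair_pow J u v (Suc n)}" if "k + l = n" for k l
      using pair_pow_monomial[of "Suc n" "Suc k" l u v J] that by (simp add: ac_simps)
  qed
  then show ?thesis using assms by (auto simp: mult.commute)
qed

lemma ideal_pow_pair: "ideal_pow (ideal_gen {u, v}) n = pair_pow {0} u v n"
proof (induction n)
  case (Suc n)
  let ?products = "{a * b | a b. a \<in> ideal_gen {u, v} \<and> b \<in> pair_pow {0} u v n}"
  have "?products \<subseteq> pair_pow {0} u v (Suc n)"
  proof clarify
    fix a b assume a: "a \<in> ideal_gen {u, v}" and b: "b \<in> pair_pow {0} u v n"
    have "{u, v} \<subseteq> {a. a * b \<in> pair_pow {0} u v (Suc n)}"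
      using mult_mem_pair_pow_Suc[OF b] mult_mem_pair_pow_Suc[of b "{0}" v u n] b pair_pow_commute by blast
    then have "ideal_gen {u, v} \<subseteq> {a. a * b \<in> pair_pow {0} u v (Suc n)}"
      by (intro ideal_gen_least is_ideal_colon is_ideal_pair_pow)
    then show "a * b \<in> pair_pow {0} u v (Suc n)" using a by blast
  qed
  moreover have "u ^ k * v ^ l \<in> ideal_gen ?products" if "k + l = Suc n" for k l
  proof (cases k)
    case 0
    then have "v * v ^ n \<in> ?products"
      using ideal_gen_base[of v "{u, v}"] pair_pow_monomial[of n 0 n u v "{0}"] by auto
    then show ?thesis using 0 that by (simp add: ideal_gen_base)
  next
    case (Suc k')
    then have "u * (u ^ k' * v ^ l) \<in> ?products"
      using ideal_gen_base[of u "{u, v}"] pair_pow_monomial[of n k' l u v "{0}"] that by auto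
    then show ?thesis using Suc by (simp add: ideal_gen_base mult.assoc)
  qed
  ultimately have "ideal_gen ?products = pair_pow {0} u v (Suc n)"
    by (intro antisym pair_pow_least ideal_gen_least is_ideal_pair_pow is_ideal_ideal_gen)
      (auto intro: ideal_zero is_ideal_ideal_gen)
  then show ?case by (simp add: ideal_prod_def Suc)
qed (simp add: pair_pow_0)

lemma adjoin_pair_pow: "adjoin (pair_pow J u v n) l = pair_pow (adjoin J l) u v n"
  unfolding pair_pow_def adjoin_ideal_gen unfolding adjoin_def ideal_gen_Un_ideal_gen by simp

lemma pair_pow_subset_adjoin: "pair_pow J u v n \<subseteq> adjoin (adjoin J u) (v ^ n)"
proof (rule pair_pow_least[OF is_ideal_adjoin])
  show "J \<subseteq> adjoin (adjoin J u) (v ^ n)" using adjoin_superset by blast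
  show "u ^ k * v ^ l \<in> adjoin (adjoin J u) (v ^ n)" if "k + l = n" for k l
  proof (cases k)
    case 0
    then show ?thesis using that adjoin_self by simp
  next
    case (Suc k')
    have "u \<in> adjoin (adjoin J u) (v ^ n)" using adjoin_superset adjoin_self by blast
    then have "u * (u ^ k' * v ^ l) \<in> adjoin (adjoin J u) (v ^ n)"
      by (rule ideal_mult_right[OF is_ideal_adjoin])
    then show ?thesis using Suc by (simp add: mult.assoc)
  qed
qed

lemma pair_pow_mult_subset: "pair_pow J u (v * w) n \<subseteq> pair_pow J u v n"
proof (rule pair_pow_least[OF is_ideal_pair_pow pair_pow_superset])
  fix k l assume "k + l = n"
  then have "u ^ k * v ^ l * w ^ l \<in> pair_pow J u v n"
    by (intro ideal_mult_right[OF is_ideal_pair_pow] pair_pow_monomial) simp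
  then show "u ^ k * (v * w) ^ l \<in> pair_pow J u v n" by (simp add: power_mult_distrib mult.assoc)
qed

lemma pair_pow_dvd_subset:
  assumes "u dvd u'" "v dvd v'" shows "pair_pow J u' v' n \<subseteq> pair_pow J u v n"
proof -
  obtain r s where "u' = u * r" "v' = v * s" using assms by (elim dvdE)
  then have "pair_pow J u' v' n \<subseteq> pair_pow J u' v n" using pair_pow_mult_subset by simp
  also have "\<dots> \<subseteq> pair_pow J u v n"
    unfolding pair_pow_commute[of J _ v] \<open>u' = u * r\<close> by (rule pair_pow_mult_subset)
  finally show ?thesis .
qed

lemma is_ideal_add_mult:
  assumes "is_ideal I" "is_ideal J" shows "is_ideal {x. \<exists>f\<in>I. x - u * f \<in> J}"
  unfolding is_ideal_def
proof (intro conjI ballI allI)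
  show "0 \<in> {x. \<exists>f\<in>I. x - u * f \<in> J}"
    using ideal_zero[OF assms(1)] ideal_zero[OF assms(2)] by (auto intro!: bexI[of _ 0])
next
  fix x y assume "x \<in> {x. \<exists>f\<in>I. x - u * f \<in> J}" "y \<in> {x. \<exists>f\<in>I. x - u * f \<in> J}"
  then obtain f g where "f \<in> I" "g \<in> I" "x - u * f \<in> J" "y - u * g \<in> J" by blast
  then have "f + g \<in> I" "(x - u * f) + (y - u * g) \<in> J" using assms by (simp_all only: ideal_add)
  then show "x + y \<in> {x. \<exists>f\<in>I. x - u * f \<in> J}"
    by (auto simp: algebra_simps intro!: bexI[of _ "f + g"])
next
  fix r x assume "x \<in> {x. \<exists>f\<in>I. x - u * f \<in> J}"
  then obtain f where "f \<in> I" "x - u * f \<in> J" by blast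
  then have "r * f \<in> I" "r * (x - u * f) \<in> J" using assms by (simp_all only: ideal_mult)
  then show "r * x \<in> {x. \<exists>f\<in>I. x - u * f \<in> J}"
    by (auto simp: algebra_simps intro!: bexI[of _ "r * f"])
qed

lemma pair_pow_Suc_eq:
  "pair_pow J u v (Suc n) = {x. \<exists>f\<in>pair_pow J u v n. x - u * f \<in> adjoin J (v ^ Suc n)}"
  (is "_ = ?R")
proof
  have memI: "x \<in> ?R" if "f \<in> pair_pow J u v n" "x - u * f \<in> adjoin J (v ^ Suc n)" for x f
    using that by blast
  note zero = ideal_zero[OF is_ideal_pair_pow]
  show "pair_pow J u v (Suc n) \<subseteq> ?R"
  proof (rule pair_pow_least[OF is_ideal_add_mult[OF is_ideal_pair_pow is_ideal_adjoin]])
    show "J \<subseteq> ?R"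
    proof
      fix j assume "j \<in> J"
      then show "j \<in> ?R" using adjoin_superset by (intro memI[of 0] zero) auto
    qed
    show "u ^ k * v ^ l \<in> ?R" if "k + l = Suc n" for k l
    proof (cases k)
      case 0
      then show ?thesis using that adjoin_self by (intro memI[of 0] zero) simp
    next
      case (Suc k')
      then show ?thesis
        using that pair_pow_monomial[of n k' l u v J] ideal_zero[OF is_ideal_adjoin]
        by (intro memI[of "u ^ k' * v ^ l"]) (simp_all add: mult.assoc)
    qed
  qed
  show "?R \<subseteq> pair_pow J u v (Suc n)"
  proof clarify
    fix x f assume f: "f \<in> pair_pow J u v n" "x - u * f \<in> adjoin J (v ^ Suc n)"
    then have "x - u * f \<in> pair_pow J u v (Suc n)" using adjoin_power_subset_pair_pow by blast
    then show "x \<in> pair_pow J u v (Suc n)"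
      using mult_mem_pair_pow_Suc[OF f(1)] ideal_diff_iff[OF is_ideal_pair_pow] by blast
  qed
qed

lemma pair_pow_cancel:
  assumes J: "is_ideal J" and u: "regular_mod J u" and v: "regular_mod (adjoin J u) v"
    and uf: "u * f \<in> pair_pow J u v (Suc n)"
  shows "f \<in> pair_pow J u v n"
proof -
  obtain g h where g: "g \<in> pair_pow J u v n" and ufg: "u * f - u * g - v ^ Suc n * h \<in> J"
    using uf unfolding pair_pow_Suc_eq mem_adjoin_iff[OF J] by blast
  have "- (u * f - u * g - v ^ Suc n * h) + u * (f - g) \<in> adjoin J u"
    using ideal_uminus[OF J ufg] by (rule adjoinI)
  then have "v ^ Suc n * h \<in> adjoin J u" by (simp add: algebra_simps)
  then have "h \<in> adjoin J u" by (rule regular_modD[OF regular_mod_power[OF v]])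
  then obtain h' where h': "h - u * h' \<in> J" using mem_adjoin_iff[OF J] by blast
  have "(u * f - u * g - v ^ Suc n * h) + v ^ Suc n * (h - u * h') \<in> J"
    using ufg h' J by (simp only: ideal_add ideal_mult)
  then have "u * (f - (g + v ^ Suc n * h')) \<in> J" by (simp add: algebra_simps)
  then have "f - (g + v ^ Suc n * h') \<in> J" by (rule regular_modD[OF u])
  moreover have "g + v ^ n * (v * h') \<in> pair_pow J u v n"
    using g power_mult_mem_pair_pow by (rule ideal_add[OF is_ideal_pair_pow])
  then have "g + v ^ Suc n * h' \<in> pair_pow J u v n" by (simp add: ac_simps)
  ultimately show ?thesis using ideal_diff_iff[OF is_ideal_pair_pow] pair_pow_superset by blast
qed

lemma regular_mod_pair_pow:
  assumes J: "is_ideal J" and u: "regular_mod J u" and v: "regular_mod (adjoin J u) v"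
    and w: "regular_mod (adjoin (adjoin J u) v) w"
  shows "regular_mod (pair_pow J u v n) w"
proof (induction n)
  case (Suc n)
  show ?case unfolding regular_mod_def
  proof (intro allI impI)
    fix f assume wf: "w * f \<in> pair_pow J u v (Suc n)"
    then have "w * f \<in> adjoin (adjoin J u) (v ^ Suc n)" using pair_pow_subset_adjoin by blast
    then have "f \<in> adjoin (adjoin J u) (v ^ Suc n)"
      using regular_modD regular_mod_adjoin_power[OF is_ideal_adjoin v w] by blast
    then obtain g where g: "f - u * g \<in> adjoin J (v ^ Suc n)"
      using mem_adjoin_iff[OF is_ideal_adjoin] adjoin_commute by blast
    then have "w * (f - u * g) \<in> pair_pow J u v (Suc n)"
      using adjoin_power_subset_pair_pow by (intro ideal_mult[OF is_ideal_pair_pow]) blast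
    then have "w * f - w * (f - u * g) \<in> pair_pow J u v (Suc n)"
      using wf by (intro ideal_diff[OF is_ideal_pair_pow])
    then have "u * (w * g) \<in> pair_pow J u v (Suc n)" by (simp add: algebra_simps)
    then have "w * g \<in> pair_pow J u v n" by (rule pair_pow_cancel[OF J u v])
    then have "g \<in> pair_pow J u v n" by (rule regular_modD[OF Suc])
    then show "f \<in> pair_pow J u v (Suc n)" using g unfolding pair_pow_Suc_eq by blast
  qed
qed (simp add: regular_mod_def pair_pow_0)

lemma mem_pair_pow_prod:
  assumes J: "is_ideal J" and B: "finite B" and u: "regular_mod J u"
    and v: "\<And>q. q \<in> B \<Longrightarrow> regular_mod (adjoin J u) (v q)"
    and pairs: "\<And>q p. q \<in> B \<Longrightarrow> p \<in> B \<Longrightarrow> q \<noteq> p \<Longrightarrow> regular_mod (adjoin (adjoin J u) (v p)) (v q)"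
    and f: "\<And>q. q \<in> B \<Longrightarrow> f \<in> pair_pow J u (v q) n"
  shows "f \<in> pair_pow J u (\<Prod>q\<in>B. v q) n"
  using f
proof (induction n arbitrary: f)
  case (Suc n)
  have "f \<in> adjoin (adjoin J u) (v q ^ Suc n)" if "q \<in> B" for q
    using Suc.prems[OF that] pair_pow_subset_adjoin by blast
  then have "f \<in> adjoin (adjoin J u) (\<Prod>q\<in>B. v q ^ Suc n)"
    by (intro mem_adjoin_prod_power[where e = "\<lambda>_. Suc n"] is_ideal_adjoin B v pairs)
  then obtain g where g: "f - u * g \<in> adjoin J ((\<Prod>q\<in>B. v q) ^ Suc n)"
    unfolding prod_power_distrib[symmetric] adjoin_commute[of J u] mem_adjoin_iff[OF is_ideal_adjoin]
    by blast
  have "g \<in> pair_pow J u (v q) n" if q: "q \<in> B" for q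
  proof (rule pair_pow_cancel[OF J u v[OF q]])
    have "pair_pow J u (\<Prod>q\<in>B. v q) (Suc n) \<subseteq> pair_pow J u (v q) (Suc n)"
      using B q by (intro pair_pow_dvd_subset dvd_prodI dvd_refl)
    then have "f - u * g \<in> pair_pow J u (v q) (Suc n)"
      using g adjoin_power_subset_pair_pow by blast
    then show "u * g \<in> pair_pow J u (v q) (Suc n)"
      using Suc.prems[OF q] ideal_diff[OF is_ideal_pair_pow]
      by (metis diff_diff_eq2 add_diff_cancel_left')
  qed
  then have "g \<in> pair_pow J u (\<Prod>q\<in>B. v q) n" by (rule Suc.IH)
  then show ?case using g unfolding pair_pow_Suc_eq by blast
qed (simp add: pair_pow_0)

section \<open>Algebraic dependence bounds depth and dimension\<close>

definition is_ring_hom :: "('a::comm_ring_1 \<Rightarrow> 'b::comm_ring_1) \<Rightarrow> bool" where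
  "is_ring_hom \<phi> \<longleftrightarrow> \<phi> 1 = 1 \<and> (\<forall>a b. \<phi> (a + b) = \<phi> a + \<phi> b) \<and> (\<forall>a b. \<phi> (a * b) = \<phi> a * \<phi> b)"

lemma ring_hom_one: "is_ring_hom \<phi> \<Longrightarrow> \<phi> 1 = 1"
  and ring_hom_add: "is_ring_hom \<phi> \<Longrightarrow> \<phi> (a + b) = \<phi> a + \<phi> b"
  and ring_hom_mult: "is_ring_hom \<phi> \<Longrightarrow> \<phi> (a * b) = \<phi> a * \<phi> b"
  by (simp_all add: is_ring_hom_def)

lemma ring_hom_zero: "is_ring_hom \<phi> \<Longrightarrow> \<phi> 0 = 0"
  using ring_hom_add[of \<phi> 0 0] by simp

lemma ring_hom_uminus: "is_ring_hom \<phi> \<Longrightarrow> \<phi> (- a) = - \<phi> a"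
  using ring_hom_add[of \<phi> a "- a"] by (simp add: ring_hom_zero eq_neg_iff_add_eq_0 add.commute)

lemma ring_hom_diff: "is_ring_hom \<phi> \<Longrightarrow> \<phi> (a - b) = \<phi> a - \<phi> b"
  using ring_hom_add[of \<phi> a "- b"] by (simp add: ring_hom_uminus)

lemma ring_hom_power: "is_ring_hom \<phi> \<Longrightarrow> \<phi> (a ^ n) = \<phi> a ^ n"
  by (induction n) (simp_all add: ring_hom_one ring_hom_mult)

lemma ring_hom_sum: "is_ring_hom \<phi> \<Longrightarrow> \<phi> (\<Sum>i\<in>A. f i) = (\<Sum>i\<in>A. \<phi> (f i))"
  by (induction A rule: infinite_finite_induct) (simp_all add: ring_hom_zero ring_hom_add)

lemma ring_hom_prod: "is_ring_hom \<phi> \<Longrightarrow> \<phi> (\<Prod>i\<in>A. f i) = (\<Prod>i\<in>A. \<phi> (f i))"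
  by (induction A rule: infinite_finite_induct) (simp_all add: ring_hom_one ring_hom_mult)

lemmas ring_hom_simps = ring_hom_one ring_hom_add ring_hom_mult ring_hom_zero ring_hom_uminus
  ring_hom_diff ring_hom_power

lemma is_ideal_kernel: "is_ring_hom \<phi> \<Longrightarrow> is_ideal {a. \<phi> a = 0}"
  by (simp add: is_ideal_def ring_hom_simps)

definition eval_along :: "('a::comm_ring_1 \<Rightarrow> 'b::comm_ring_1) \<Rightarrow> 'b \<Rightarrow> 'a poly \<Rightarrow> 'b" where
  "eval_along \<phi> x p = poly (map_poly \<phi> p) x"

lemma eval_along_0: "eval_along \<phi> x 0 = 0"
  by (simp add: eval_along_def)

lemma eval_along_pCons:
  "is_ring_hom \<phi> \<Longrightarrow> eval_along \<phi> x (pCons a p) = \<phi> a + x * eval_along \<phi> x p"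
  by (simp add: eval_along_def map_poly_pCons ring_hom_zero)

lemma is_ring_hom_eval_along:
  assumes \<phi>: "is_ring_hom \<phi>" shows "is_ring_hom (eval_along \<phi> x)"
proof -
  note simps = eval_along_0 eval_along_pCons[OF \<phi>] ring_hom_simps[OF \<phi>]
  have add: "eval_along \<phi> x (p + q) = eval_along \<phi> x p + eval_along \<phi> x q" for p q
    by (induction p q rule: poly_induct2) (simp_all add: simps algebra_simps)
  have smult: "eval_along \<phi> x (smult a p) = \<phi> a * eval_along \<phi> x p" for a p
    by (induction p) (simp_all add: simps algebra_simps)
  have "eval_along \<phi> x (p * q) = eval_along \<phi> x p * eval_along \<phi> x q" for p q
    by (induction p) (simp_all add: simps add smult algebra_simps)
  moreover have "eval_along \<phi> x 1 = 1" by (simp add: simps one_pCons)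
  ultimately show ?thesis using add by (simp add: is_ring_hom_def)
qed

lemma eval_along_monom: "is_ring_hom \<phi> \<Longrightarrow> eval_along \<phi> x (monom a n) = \<phi> a * x ^ n"
  by (simp add: eval_along_def map_poly_monom ring_hom_zero poly_monom)

lemma ring_hom_eval_along:
  assumes "is_ring_hom \<psi>" "is_ring_hom \<phi>"
  shows "\<psi> (eval_along \<phi> x p) = eval_along (\<lambda>a. \<psi> (\<phi> a)) (\<psi> x) p"
proof -
  have "is_ring_hom (\<lambda>a. \<psi> (\<phi> a))" using assms by (simp add: is_ring_hom_def)
  then show ?thesis
    by (induction p) (simp_all add: eval_along_0 eval_along_pCons ring_hom_simps assms)
qed

definition eval3 ::
  "('k::comm_ring_1 \<Rightarrow> 'a::comm_ring_1) \<Rightarrow> 'a \<Rightarrow> 'a \<Rightarrow> 'a \<Rightarrow> 'k poly poly poly \<Rightarrow> 'a" where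
  "eval3 \<kappa> f g h = eval_along (eval_along (eval_along \<kappa> h) g) f"

lemma is_ring_hom_eval3: "is_ring_hom \<kappa> \<Longrightarrow> is_ring_hom (eval3 \<kappa> f g h)"
  by (simp add: eval3_def is_ring_hom_eval_along)

lemma ring_hom_eval3:
  assumes "is_ring_hom \<psi>" "is_ring_hom \<kappa>"
  shows "\<psi> (eval3 \<kappa> f g h Q) = eval3 (\<lambda>c. \<psi> (\<kappa> c)) (\<psi> f) (\<psi> g) (\<psi> h) Q"
  unfolding eval3_def using assms by (simp add: ring_hom_eval_along is_ring_hom_eval_along)

definition alg_dependent_mod ::
  "('k::comm_ring_1 \<Rightarrow> 'a::comm_ring_1) \<Rightarrow> 'a set \<Rightarrow> 'a \<Rightarrow> 'a \<Rightarrow> 'a \<Rightarrow> bool" where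
  "alg_dependent_mod \<kappa> J f g h \<longleftrightarrow> (\<exists>Q. Q \<noteq> 0 \<and> eval3 \<kappa> f g h Q \<in> J)"

lemma eval_along_mem_imp_coeff_mem:
  assumes \<phi>: "is_ring_hom \<phi>" and J': "is_ideal J'" "J \<subseteq> J'" and f: "f \<in> J'" "regular_mod J f"
    and "p \<noteq> 0" "eval_along \<phi> f p \<in> J"
  shows "\<exists>a. a \<noteq> 0 \<and> \<phi> a \<in> J'"
  using assms(6,7)
proof (induction p)
  case (pCons a p)
  show ?case
  proof (cases "a = 0")
    case True
    then have "f * eval_along \<phi> f p \<in> J"
      using pCons.prems by (simp add: eval_along_pCons \<phi> ring_hom_zero)
    then show ?thesis using pCons True regular_modD[OF f(2)] by auto
  next
    case False
    have "\<phi> a + f * eval_along \<phi> f p \<in> J'" using pCons.prems J' by (auto simp: eval_along_pCons \<phi>)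
    then have "\<phi> a \<in> J'"
      using ideal_diff[OF J'(1) _ ideal_mult_right[OF J'(1) f(1)]] by (metis add_diff_cancel_right')
    with False show ?thesis by blast
  qed
qed simp

text \<open>A relation is stripped of one variable at each step of the chain, taking the coefficient of
  the lowest power that occurs; what remains is a nonzero constant.\<close>
lemma alg_dependent_mod_chain:
  fixes \<kappa> :: "'k::field \<Rightarrow> 'a::comm_ring_1"
  assumes \<kappa>: "is_ring_hom \<kappa>" and dep: "alg_dependent_mod \<kappa> J0 f1 f2 f3"
    and "is_ideal J1" "J0 \<subseteq> J1" "f1 \<in> J1" "regular_mod J0 f1"
    and "is_ideal J2" "J1 \<subseteq> J2" "f2 \<in> J2" "regular_mod J1 f2"
    and "is_ideal J3" "J2 \<subseteq> J3" "f3 \<in> J3" "regular_mod J2 f3"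
  shows "J3 = UNIV"
proof -
  obtain Q where Q: "Q \<noteq> 0" "eval_along (eval_along (eval_along \<kappa> f3) f2) f1 Q \<in> J0"
    using dep by (auto simp: alg_dependent_mod_def eval3_def)
  obtain q where q: "q \<noteq> 0" "eval_along (eval_along \<kappa> f3) f2 q \<in> J1"
    using eval_along_mem_imp_coeff_mem[OF _ assms(3-6) Q] by (auto simp: is_ring_hom_eval_along \<kappa>)
  obtain r where r: "r \<noteq> 0" "eval_along \<kappa> f3 r \<in> J2"
    using eval_along_mem_imp_coeff_mem[OF _ assms(7-10) q] by (auto simp: is_ring_hom_eval_along \<kappa>)
  obtain a where a: "a \<noteq> 0" "\<kappa> a \<in> J3"
    using eval_along_mem_imp_coeff_mem[OF \<kappa> assms(11-14) r] by blast
  then have "\<kappa> (inverse a) * \<kappa> a = 1" by (simp add: ring_hom_one \<kappa> flip: ring_hom_mult)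
  then show ?thesis using a ideal_mult[OF \<open>is_ideal J3\<close>] ideal_eq_UNIV[OF \<open>is_ideal J3\<close>] by metis
qed

lemma krull_dim_quot_le_two:
  fixes \<kappa> :: "'k::field \<Rightarrow> 'a::comm_ring_1"
  assumes \<kappa>: "is_ring_hom \<kappa>" and dep: "\<And>f g h. alg_dependent_mod \<kappa> I f g h"
  shows "krull_dim_quot I \<le> 2"
  unfolding krull_dim_quot_def
proof (rule Sup_least, clarify)
  fix n and P :: "nat \<Rightarrow> 'a set"
  assume P: "\<forall>i\<le>n. prime_ideal (P i) \<and> I \<subseteq> P i" and chain: "\<forall>i<n. P i \<subset> P (Suc i)"
  have "n \<le> 2"
  proof (rule ccontr)
    assume "\<not> n \<le> 2"
    then have sub: "P 0 \<subset> P 1" "P 1 \<subset> P 2" "P 2 \<subset> P 3"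
      and prime: "prime_ideal (P 0)" "prime_ideal (P 1)" "prime_ideal (P 2)" "prime_ideal (P 3)"
      and "I \<subseteq> P 0"
      using P chain by (auto simp: numeral_2_eq_2 numeral_3_eq_3)
    obtain f g h where fgh: "f \<in> P 1 - P 0" "g \<in> P 2 - P 1" "h \<in> P 3 - P 2" using sub by blast
    have "alg_dependent_mod \<kappa> (P 0) f g h"
      using dep[of f g h] \<open>I \<subseteq> P 0\<close> by (auto simp: alg_dependent_mod_def)
    then have "P 3 = UNIV"
      using alg_dependent_mod_chain[OF \<kappa>, of "P 0" f g h "P 1" "P 2" "P 3"] fgh sub prime
      by (simp add: prime_ideal_is_ideal regular_mod_prime psubset_imp_subset)
    then show False using prime by (simp add: prime_ideal_def)
  qed
  then show "enat n \<le> 2" by (simp add: numeral_eq_enat)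
qed

lemma depth_quot_le_two:
  fixes \<kappa> :: "'l::field \<Rightarrow> 'k::comm_ring_1 bpoly"
  assumes \<kappa>: "is_ring_hom \<kappa>" and dep: "\<And>f g h. alg_dependent_mod \<kappa> I f g h" and I: "is_ideal I"
  shows "depth_quot I \<le> 2"
  unfolding depth_quot_def
proof (rule Sup_least, clarify)
  fix fs assume fs: "regular_seq I fs"
  have "length fs \<le> 2"
  proof (rule ccontr)
    assume "\<not> length fs \<le> 2"
    then obtain f g h gs where "fs = f # g # h # gs"
      by (cases fs rule: remdups_adj.cases; cases "tl (tl fs)") auto
    then have regular: "regular_mod I f" "regular_mod (adjoin I f) g"
        "regular_mod (adjoin (adjoin I f) g) h" "regular_seq (adjoin (adjoin (adjoin I f) g) h) gs"
      using fs by (simp_all add: regular_seq_Cons I is_ideal_adjoin)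
    then have "adjoin (adjoin (adjoin I f) g) h = UNIV"
      by (intro alg_dependent_mod_chain[OF \<kappa> dep[of f g h]])
        (simp_all add: is_ideal_adjoin adjoin_superset adjoin_self)
    moreover have "\<not> regular_seq UNIV gs"
    proof -
      have "ideal_gen (UNIV \<union> set gs) = UNIV" using ideal_gen_superset by blast
      then show ?thesis by (simp add: regular_seq_def ideal_sum_ideal_gen)
    qed
    ultimately show False using regular(4) by simp
  qed
  then show "enat (length fs) \<le> 2" by (simp add: numeral_eq_enat)
qed

lemma (in vector_space) ex_linear_relation:
  assumes "finite A" "finite T" "v ` A \<subseteq> span T" "card T < card A"
  obtains c a where "a \<in> A" "c a \<noteq> 0" "(\<Sum>a\<in>A. c a *s v a) = 0"
proof (cases "inj_on v A")
  case True
  then have "card (v ` A) > card T" using assms(4) by (simp add: card_image)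
  then have "dependent (v ` A)" using independent_span_bound[OF assms(2) _ assms(3)] by auto
  then obtain u a where "a \<in> A" "u (v a) \<noteq> 0" "(\<Sum>w\<in>v ` A. u w *s w) = 0"
    using dependent_finite[of "v ` A"] assms(1) by auto
  then show ?thesis
    using that[of a "\<lambda>a. u (v a)"] True by (simp add: sum.reindex)
next
  case False
  then obtain a b where ab: "a \<in> A" "b \<in> A" "v a = v b" "a \<noteq> b" by (auto simp: inj_on_def)
  define c where "c x = (if x = a then 1 else if x = b then - 1 else 0 :: 'a)" for x
  have "(\<Sum>x\<in>A. c x *s v x) = (\<Sum>x\<in>{a, b}. c x *s v x)"
    using ab assms(1) by (intro sum.mono_neutral_right) (auto simp: c_def)
  then show ?thesis using that[of a c] ab by (simp add: c_def)
qed

definition monomial_span ::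
  "('k::field \<Rightarrow> 'a::comm_ring_1) \<Rightarrow> 'a \<Rightarrow> 'a \<Rightarrow> nat \<Rightarrow> 'a set" where
  "monomial_span \<kappa> s t d =
     module.span (\<lambda>c x. \<kappa> c * x) ((\<lambda>(i, j). s ^ i * t ^ j) ` ({..d} \<times> {..d}))"

lemma vector_space_ring_hom:
  fixes \<kappa> :: "'k::field \<Rightarrow> 'a::comm_ring_1"
  assumes "is_ring_hom \<kappa>" shows "vector_space (\<lambda>c x. \<kappa> c * x)"
  by standard (simp_all add: ring_hom_simps[OF assms] algebra_simps)

context
  fixes \<kappa> :: "'k::field \<Rightarrow> 'a::comm_ring_1" and s t :: 'a
  assumes \<kappa>: "is_ring_hom \<kappa>"
begin

interpretation vector_space "\<lambda>c x. \<kappa> c * x"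
  by (rule vector_space_ring_hom[OF \<kappa>])

lemma monomial_in_monomial_span: "i \<le> d \<Longrightarrow> j \<le> d \<Longrightarrow> s ^ i * t ^ j \<in> monomial_span \<kappa> s t d"
  unfolding monomial_span_def by (rule span_base) auto

lemma monomial_span_least:
  assumes "subspace V" "\<And>i j. i \<le> d \<Longrightarrow> j \<le> d \<Longrightarrow> s ^ i * t ^ j \<in> V"
  shows "monomial_span \<kappa> s t d \<subseteq> V"
  unfolding monomial_span_def using assms by (intro span_minimal) auto

lemma subspace_monomial_span: "subspace (monomial_span \<kappa> s t d)"
  by (simp add: monomial_span_def)

lemma monomial_span_mono:
  assumes "d \<le> e" shows "monomial_span \<kappa> s t d \<subseteq> monomial_span \<kappa> s t e"
  using assms by (intro monomial_span_least subspace_monomial_span monomial_in_monomial_span) auto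

lemma scaled_monomial_in_monomial_span: "\<kappa> c * (s ^ i * t ^ j) \<in> monomial_span \<kappa> s t (max i j)"
  by (intro subspace_scale[OF subspace_monomial_span] monomial_in_monomial_span) auto

lemma monomial_span_add:
  assumes "x \<in> monomial_span \<kappa> s t d" "y \<in> monomial_span \<kappa> s t e"
  shows "x + y \<in> monomial_span \<kappa> s t (max d e)"
  using assms monomial_span_mono[of d "max d e"] monomial_span_mono[of e "max d e"]
  by (intro subspace_add[OF subspace_monomial_span]) auto

lemma monomial_span_mult:
  assumes x: "x \<in> monomial_span \<kappa> s t d" and y: "y \<in> monomial_span \<kappa> s t e"
  shows "x * y \<in> monomial_span \<kappa> s t (d + e)"
proof -
  have subspace_colon: "subspace {x. x * z \<in> monomial_span \<kappa> s t n}" for z n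
    using subspace_monomial_span[of n] by (auto simp: subspace_def distrib_right mult.assoc)
  have "s ^ i * t ^ j * y \<in> monomial_span \<kappa> s t (d + e)" if ij: "i \<le> d" "j \<le> d" for i j
  proof -
    have "s ^ k * t ^ l * (s ^ i * t ^ j) \<in> monomial_span \<kappa> s t (d + e)" if "k \<le> e" "l \<le> e" for k l
      using monomial_in_monomial_span[of "i + k" "d + e" "j + l"] ij that
      by (simp add: power_add ac_simps)
    then have "monomial_span \<kappa> s t e \<subseteq> {y. y * (s ^ i * t ^ j) \<in> monomial_span \<kappa> s t (d + e)}"
      by (intro monomial_span_least subspace_colon) simp
    then show ?thesis using y by (auto simp: mult.commute)
  qed
  then have "monomial_span \<kappa> s t d \<subseteq> {x. x * y \<in> monomial_span \<kappa> s t (d + e)}"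
    by (intro monomial_span_least subspace_colon) simp
  then show ?thesis using x by blast
qed

lemma monomial_span_power:
  "x \<in> monomial_span \<kappa> s t d \<Longrightarrow> x ^ n \<in> monomial_span \<kappa> s t (n * d)"
proof (induction n)
  case 0
  then show ?case using monomial_in_monomial_span[of 0 0 0] by simp
next
  case (Suc n)
  then show ?case using monomial_span_mult by simp
qed

text \<open>There are \<open>N\<^sup>3\<close> monomials in \<open>f\<close>, \<open>g\<close>, \<open>h\<close> with exponents below \<open>N\<close>, in a space of dimension
  of order \<open>N\<^sup>2\<close>.\<close>
lemma monomial_span_linear_relation:
  assumes fgh: "f \<in> monomial_span \<kappa> s t d" "g \<in> monomial_span \<kappa> s t d" "h \<in> monomial_span \<kappa> s t d"
  obtains N c i\<^sub>0 j\<^sub>0 k\<^sub>0 where "i\<^sub>0 < N" "j\<^sub>0 < N" "k\<^sub>0 < N" "c (i\<^sub>0, j\<^sub>0, k\<^sub>0) \<noteq> 0"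
    "(\<Sum>(i, j, k)\<in>{..<N} \<times> {..<N} \<times> {..<N}. \<kappa> (c (i, j, k)) * (f ^ i * g ^ j * h ^ k)) = 0"
proof -
  define N where "N = 16 * Suc d ^ 2 + 1"
  define D where "D = N * d + N * d + N * d"
  let ?A = "{..<N} \<times> {..<N} \<times> {..<N}" and ?T = "(\<lambda>(i, j). s ^ i * t ^ j) ` ({..D} \<times> {..D})"
  let ?v = "\<lambda>(i, j, k). f ^ i * g ^ j * h ^ k"
  have "card ?T \<le> Suc D * Suc D"
    using card_image_le[of "{..D} \<times> {..D}" "\<lambda>(i, j). s ^ i * t ^ j"] by simp
  also have "\<dots> \<le> (4 * Suc d * N) * (4 * Suc d * N)"
    by (intro mult_mono) (simp_all add: D_def N_def algebra_simps)
  also have "\<dots> = (16 * Suc d ^ 2) * (N * N)" by (simp add: power2_eq_square algebra_simps)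
  also have "\<dots> < N * (N * N)" by (intro mult_strict_right_mono) (simp_all add: N_def)
  also have "\<dots> = card ?A" by (simp add: card_cartesian_product)
  finally have card: "card ?T < card ?A" .
  have in_span: "?v ` ?A \<subseteq> span ?T"
  proof clarify
    fix i j k assume "i < N" "j < N" "k < N"
    then have "i * d + j * d + k * d \<le> D" unfolding D_def by (intro add_mono mult_right_mono) auto
    moreover have "f ^ i * g ^ j * h ^ k \<in> monomial_span \<kappa> s t (i * d + j * d + k * d)"
      using fgh by (intro monomial_span_mult monomial_span_power)
    ultimately have "f ^ i * g ^ j * h ^ k \<in> monomial_span \<kappa> s t D" using monomial_span_mono by blast
    then show "f ^ i * g ^ j * h ^ k \<in> span ?T" by (simp only: monomial_span_def)
  qed
  have "finite ?A" "finite ?T" by simp_all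
  then obtain c a where "a \<in> ?A" "c a \<noteq> 0" "(\<Sum>a\<in>?A. \<kappa> (c a) * ?v a) = 0"
    by (rule ex_linear_relation[OF _ _ in_span card])
  then show ?thesis using that[of "fst a" N "fst (snd a)" "snd (snd a)" c]
    by (auto simp: case_prod_unfold)
qed

lemma monomial_span_alg_dependent:
  assumes "f \<in> monomial_span \<kappa> s t d" "g \<in> monomial_span \<kappa> s t d" "h \<in> monomial_span \<kappa> s t d"
  shows "alg_dependent_mod \<kappa> {0} f g h"
proof -
  obtain N c i\<^sub>0 j\<^sub>0 k\<^sub>0 where less: "i\<^sub>0 < N" "j\<^sub>0 < N" "k\<^sub>0 < N" and nz: "c (i\<^sub>0, j\<^sub>0, k\<^sub>0) \<noteq> 0"
    and relation: "(\<Sum>(i, j, k)\<in>{..<N} \<times> {..<N} \<times> {..<N}. \<kappa> (c (i, j, k)) * (f ^ i * g ^ j * h ^ k)) = 0"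
    using monomial_span_linear_relation[OF assms] .
  define Q where "Q = (\<Sum>i<N. monom (\<Sum>j<N. monom (\<Sum>k<N. monom (c (i, j, k)) k) j) i)"
  have "coeff (coeff (coeff Q i\<^sub>0) j\<^sub>0) k\<^sub>0 = c (i\<^sub>0, j\<^sub>0, k\<^sub>0)"
    using less by (simp add: Q_def coeff_sum)
  then have "Q \<noteq> 0" using nz by auto
  moreover have "eval3 \<kappa> f g h Q = (\<Sum>i<N. \<Sum>j<N. \<Sum>k<N. \<kappa> (c (i, j, k)) * (f ^ i * g ^ j * h ^ k))"
    by (simp add: eval3_def Q_def ring_hom_sum eval_along_monom is_ring_hom_eval_along \<kappa>
        sum_distrib_left ac_simps)
  then have "eval3 \<kappa> f g h Q = 0" using relation by (simp add: sum.cartesian_product)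
  ultimately show ?thesis by (auto simp: alg_dependent_mod_def)
qed

end

lemma alg_dependent_mod_kernel:
  assumes "is_ring_hom \<phi>" "is_ring_hom \<kappa>" "\<And>c. \<phi> (\<kappa> c) = \<kappa> c"
    and "alg_dependent_mod \<kappa> {0} (\<phi> f) (\<phi> g) (\<phi> h)"
  shows "alg_dependent_mod \<kappa> {a. \<phi> a = 0} f g h"
  using assms by (simp add: alg_dependent_mod_def ring_hom_eval3)

section \<open>The polynomial ring\<close>

text \<open>The order on the variables makes the polynomial ring an instance of \<open>idom\<close>.\<close>
instantiation var :: linorder
begin

fun var_index :: "var \<Rightarrow> nat" where
  "var_index X0 = 0" | "var_index X1 = 1" | "var_index Y0 = 2" | "var_index Y1 = 3"

definition less_eq_var :: "var \<Rightarrow> var \<Rightarrow> bool" where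
  "less_eq_var v w \<longleftrightarrow> var_index v \<le> var_index w"

definition less_var :: "var \<Rightarrow> var \<Rightarrow> bool" where
  "less_var v w \<longleftrightarrow> var_index v < var_index w"

instance
proof
  show "v = w" if "v \<le> w" "w \<le> v" for v w :: var
    using that by (cases v; cases w) (simp_all add: less_eq_var_def)
qed (auto simp: less_eq_var_def less_var_def)

end

lemma is_ring_hom_Const: "is_ring_hom Const"
  by (simp add: is_ring_hom_def Const_def single_add mult_single)

lemmas Const_simps = ring_hom_simps[OF is_ring_hom_Const]

lemma Const_inverse_mult_cancel:
  fixes a :: "'k::field"
  assumes "a \<noteq> 0" shows "Const (inverse a) * (Const a * f) = f"
  using assms by (simp add: Const_simps flip: mult.assoc ring_hom_mult[OF is_ring_hom_Const])

lemma Const_eq_0_iff: "Const a = 0 \<longleftrightarrow> a = 0"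
  by (metis Const_def lookup_single_eq lookup_zero single_zero)

lemma Var_neq_0: "Var v \<noteq> (0 :: 'k::comm_ring_1 bpoly)"
  by (metis Var_def lookup_single_eq lookup_zero zero_neq_one)

lemma poly_mapping_single_induct [case_names single add]:
  assumes single: "\<And>\<mu> a. P (Poly_Mapping.single \<mu> a)"
    and add: "\<And>f g. P f \<Longrightarrow> P g \<Longrightarrow> P (f + g)"
  shows "P (f :: 'a \<Rightarrow>\<^sub>0 'b::comm_monoid_add)"
proof (induction f rule: update_induct)
  case const
  show ?case using single[of _ 0] by simp
next
  case (update f a b)
  then have "Poly_Mapping.update a b f = f + Poly_Mapping.single a b"
    by (intro poly_mapping_eqI) (auto simp: lookup_update lookup_add lookup_single in_keys_iff when_def)
  then show ?case using add[OF update.IH single] by simp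
qed

lemma Var_power: "Var v ^ n = Poly_Mapping.single (Poly_Mapping.single v n) 1"
  by (induction n) (simp_all add: Var_def mult_single flip: single_add)

lemma single_eq_monomial:
  "Poly_Mapping.single \<mu> a = Const a * (\<Prod>v\<in>{X0, X1, Y0, Y1}. Var v ^ Poly_Mapping.lookup \<mu> v)"
proof -
  have "\<mu> = (\<Sum>v\<in>{X0, X1, Y0, Y1}. Poly_Mapping.single v (Poly_Mapping.lookup \<mu> v))"
  proof (rule poly_mapping_eqI)
    fix w show "Poly_Mapping.lookup \<mu> w =
      Poly_Mapping.lookup (\<Sum>v\<in>{X0, X1, Y0, Y1}. Poly_Mapping.single v (Poly_Mapping.lookup \<mu> v)) w"
      by (cases w) (simp_all add: lookup_add lookup_single)
  qed
  then show ?thesis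
    by (simp add: Var_power mult_single Const_def add.assoc)
qed

lemma bpoly_induct [case_names Const Var add mult]:
  fixes f :: "'k::comm_ring_1 bpoly"
  assumes Const: "\<And>c. P (Const c)" and Var: "\<And>v. P (Var v)"
    and add: "\<And>f g. P f \<Longrightarrow> P g \<Longrightarrow> P (f + g)" and mult: "\<And>f g. P f \<Longrightarrow> P g \<Longrightarrow> P (f * g)"
  shows "P f"
proof (induction f rule: poly_mapping_single_induct)
  case (single \<mu> a)
  have "P (Var v ^ n)" for v n
    using Const[of 1] by (induction n) (auto simp: Const_simps intro: Var mult)
  then show ?case unfolding single_eq_monomial by (auto intro!: mult Const)
qed (rule add)

definition bsubst :: "(var \<Rightarrow> 'k bpoly) \<Rightarrow> 'k::comm_ring_1 bpoly \<Rightarrow> 'k bpoly" where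
  "bsubst c f = (\<Sum>\<mu>\<in>Poly_Mapping.keys f.
     Const (Poly_Mapping.lookup f \<mu>) * (\<Prod>v\<in>{X0, X1, Y0, Y1}. c v ^ Poly_Mapping.lookup \<mu> v))"

lemma bsubst_eq_sum:
  assumes "finite A" "Poly_Mapping.keys f \<subseteq> A"
  shows "bsubst c f = (\<Sum>\<mu>\<in>A.
     Const (Poly_Mapping.lookup f \<mu>) * (\<Prod>v\<in>{X0, X1, Y0, Y1}. c v ^ Poly_Mapping.lookup \<mu> v))"
  unfolding bsubst_def using assms
  by (intro sum.mono_neutral_left) (auto simp: in_keys_iff Const_simps)

lemma bsubst_add: "bsubst c (f + g) = bsubst c f + bsubst c g"
proof -
  let ?A = "Poly_Mapping.keys f \<union> Poly_Mapping.keys g"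
  have "Poly_Mapping.keys (f + g) \<subseteq> ?A" by (rule keys_add)
  then show ?thesis
    by (simp add: bsubst_eq_sum[of ?A] lookup_add Const_simps distrib_right sum.distrib del: prod.insert)
qed

lemma bsubst_single:
  "bsubst c (Poly_Mapping.single \<mu> a) = Const a * (\<Prod>v\<in>{X0, X1, Y0, Y1}. c v ^ Poly_Mapping.lookup \<mu> v)"
  by (subst bsubst_eq_sum[of "{\<mu>}"]) auto

lemma is_ring_hom_bsubst: "is_ring_hom (bsubst c)"
proof -
  have "bsubst c (f * g) = bsubst c f * bsubst c g" for f g
  proof (induction f rule: poly_mapping_single_induct)
    case (single \<mu> a)
    show ?case
    proof (induction g rule: poly_mapping_single_induct)
      case (single \<nu> b)
      show ?case
        unfolding mult_single bsubst_single lookup_add power_add prod.distrib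
          ring_hom_mult[OF is_ring_hom_Const]
        by (simp only: ac_simps)
    qed (simp add: distrib_left bsubst_add)
  qed (simp add: distrib_right bsubst_add)
  moreover have "bsubst c 1 = 1"
    using bsubst_single[of c 0 1] by (simp add: Const_simps)
  ultimately show ?thesis by (simp add: is_ring_hom_def bsubst_add)
qed

lemma bsubst_Const: "bsubst c (Const a) = Const a"
  unfolding Const_def by (subst bsubst_single) (simp add: Const_def)

lemma bsubst_Var: "bsubst c (Var v) = c v"
  unfolding Var_def by (subst bsubst_single) (cases v; simp add: Const_simps lookup_single)

lemmas bsubst_simps = bsubst_Const bsubst_Var ring_hom_simps[OF is_ring_hom_bsubst]

lemma bsubst_diff_mem:
  fixes J :: "'k::comm_ring_1 bpoly set"
  assumes J: "is_ideal J" and c: "\<And>v. c v - Var v \<in> J"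
  shows "bsubst c f - f \<in> J"
proof (induction f rule: bpoly_induct)
  case (Const a)
  then show ?case using ideal_zero[OF J] by (simp add: bsubst_simps)
next
  case (Var v)
  then show ?case using c by (simp add: bsubst_simps)
next
  case (add f g)
  then show ?case using ideal_add[OF J add] by (simp add: bsubst_simps algebra_simps)
next
  case (mult f g)
  have "bsubst c (f * g) - f * g = bsubst c f * (bsubst c g - g) + g * (bsubst c f - f)"
    by (simp add: bsubst_simps algebra_simps)
  then show ?case using mult J by (simp add: ideal_add ideal_mult)
qed

section \<open>Ideals of products of linear subspaces\<close>

definition lform :: "var \<Rightarrow> var \<Rightarrow> 'k \<times> 'k \<Rightarrow> 'k::comm_ring_1 bpoly" where
  "lform u v p = Const (snd p) * Var u - Const (fst p) * Var v"

abbreviation "xform \<equiv> lform X0 X1"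
abbreviation "yform \<equiv> lform Y0 Y1"

definition normal :: "'k::field \<times> 'k \<Rightarrow> bool" where
  "normal p \<longleftrightarrow> snd p = 1 \<or> p = (1, 0)"

lemma normal_det:
  "normal p \<Longrightarrow> normal q \<Longrightarrow> snd p * fst q - fst p * snd q = 0 \<longleftrightarrow> p = q"
  by (auto simp: normal_def prod_eq_iff)

lemma ex_normal_neq: "\<exists>p. normal p \<and> p \<noteq> q"
  by (metis fst_conv normal_def snd_conv zero_neq_one)

lemma lform_neq_0:
  assumes "u \<noteq> v" "normal p" shows "lform u v p \<noteq> 0"
proof
  assume "lform u v p = 0"
  then have "bsubst c (lform u v p) = 0" for c by (simp add: bsubst_simps)
  from this[of "\<lambda>w. if w = u then 1 else 0"] this[of "\<lambda>w. if w = v then 1 else 0"] show False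
    using assms by (auto simp: lform_def bsubst_simps normal_def Const_eq_0_iff)
qed

lemma variables_mult_mem:
  assumes J: "is_ideal J" and "normal p" "normal q" "p \<noteq> q"
    and p: "lform u v p * w \<in> J" and q: "lform u v q * w \<in> J"
  shows "Var u * w \<in> J" "Var v * w \<in> J"
proof -
  define d where "d = snd p * fst q - fst p * snd q"
  have "d \<noteq> 0" using normal_det[of p q] assms(2-4) by (simp add: d_def)
  have mem: "f \<in> J" if "Const a * (lform u v p * w) - Const b * (lform u v q * w) = Const d * f" for a b f
  proof -
    have "Const d * f \<in> J"
      unfolding that[symmetric] by (intro ideal_diff ideal_mult J p q)
    then have "Const (inverse d) * (Const d * f) \<in> J" by (rule ideal_mult[OF J])
    then show ?thesis using \<open>d \<noteq> 0\<close> by (simp add: Const_inverse_mult_cancel)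
  qed
  show "Var u * w \<in> J" "Var v * w \<in> J"
    by (rule mem[of "fst q" "fst p"] mem[of "snd q" "snd p"],
        simp add: lform_def d_def Const_simps algebra_simps)+
qed

lemma lform_mem: "is_ideal J \<Longrightarrow> Var u \<in> J \<Longrightarrow> Var v \<in> J \<Longrightarrow> lform u v p \<in> J"
  by (simp add: lform_def ideal_diff ideal_mult)

lemma lform_mult_mem:
  assumes "is_ideal J" "normal p" "normal q" "p \<noteq> q" "lform u v p * w \<in> J" "lform u v q * w \<in> J"
  shows "lform u v r * w \<in> J"
  using lform_mem[OF is_ideal_colon[OF assms(1)], of u w v r] variables_mult_mem[OF assms] by simp

lemma ideal_gen_two_lforms:
  assumes "normal p" "normal q" "p \<noteq> q"
  shows "ideal_gen (insert (lform u v p) (insert (lform u v q) G)) =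
    ideal_gen (insert (Var u) (insert (Var v) G))"
proof -
  let ?forms = "insert (lform u v p) (insert (lform u v q) G)"
  have "Var u * 1 \<in> ideal_gen ?forms" "Var v * 1 \<in> ideal_gen ?forms"
    using variables_mult_mem[OF is_ideal_ideal_gen assms, of u v 1 ?forms]
    by (simp_all add: ideal_gen_base)
  then show ?thesis
    unfolding ideal_gen_eq_iff
    by (auto intro: ideal_gen_base lform_mem[OF is_ideal_ideal_gen])
qed

datatype 'k plane_subspace = Plane | Line "'k \<times> 'k" | Origin

fun normal_subspace :: "'k::field plane_subspace \<Rightarrow> bool" where
  "normal_subspace (Line p) = normal p"
| "normal_subspace _ = True"

fun meet_line :: "'k \<times> 'k \<Rightarrow> 'k plane_subspace \<Rightarrow> 'k plane_subspace" where
  "meet_line p Plane = Line p"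
| "meet_line p (Line q) = (if p = q then Line q else Origin)"
| "meet_line p Origin = Origin"

lemma normal_meet_line: "normal p \<Longrightarrow> normal_subspace A \<Longrightarrow> normal_subspace (meet_line p A)"
  by (cases A) auto

fun subspace_forms :: "var \<Rightarrow> var \<Rightarrow> 'k::comm_ring_1 plane_subspace \<Rightarrow> 'k bpoly set" where
  "subspace_forms u v Plane = {}"
| "subspace_forms u v (Line p) = {lform u v p}"
| "subspace_forms u v Origin = {Var u, Var v}"

definition line_coordinate :: "var \<Rightarrow> var \<Rightarrow> 'k \<times> 'k \<Rightarrow> 'k::comm_ring_1 bpoly" where
  "line_coordinate u v p = (if snd p = 1 then Var v else Var u)"

fun subspace_parametrization ::
  "var \<Rightarrow> var \<Rightarrow> 'k::comm_ring_1 plane_subspace \<Rightarrow> 'k bpoly \<times> 'k bpoly" where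
  "subspace_parametrization u v Plane = (Var u, Var v)"
| "subspace_parametrization u v (Line p) =
     (Const (fst p) * line_coordinate u v p, Const (snd p) * line_coordinate u v p)"
| "subspace_parametrization u v Origin = (0, 0)"

lemma subspace_forms_meet_line:
  assumes "normal p" "normal_subspace A"
  shows "ideal_gen (insert (lform u v p) (subspace_forms u v A \<union> G)) =
    ideal_gen (subspace_forms u v (meet_line p A) \<union> G)"
proof (cases A)
  case (Line q)
  then show ?thesis using assms ideal_gen_two_lforms[of p q] by auto
next
  case Origin
  then have "lform u v p \<in> ideal_gen (subspace_forms u v A \<union> G)"
    by (auto intro: ideal_gen_base lform_mem[OF is_ideal_ideal_gen])
  then show ?thesis
    using Origin unfolding ideal_gen_eq_iff by (auto intro: ideal_gen_base)
qed simp

lemma subspace_parametrization_diff_mem: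
  assumes "normal_subspace A" "is_ideal J" "subspace_forms u v A \<subseteq> J"
  shows "fst (subspace_parametrization u v A) - Var u \<in> J"
    and "snd (subspace_parametrization u v A) - Var v \<in> J"
proof (atomize (full), cases A)
  case (Line p)
  then have "lform u v p \<in> J" "- lform u v p \<in> J" "0 \<in> J" "normal p"
    using assms by (auto intro: ideal_uminus ideal_zero)
  then show "fst (subspace_parametrization u v A) - Var u \<in> J \<and>
      snd (subspace_parametrization u v A) - Var v \<in> J"
    using Line by (auto simp: normal_def line_coordinate_def lform_def Const_simps)
qed (use assms in \<open>auto intro: ideal_zero ideal_uminus\<close>)

lemma subspace_forms_vanish:
  assumes "c u = fst (subspace_parametrization u v A)" "c v = snd (subspace_parametrization u v A)"
    and "g \<in> subspace_forms u v A"
  shows "bsubst c g = 0"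
  using assms by (cases A) (auto simp: lform_def bsubst_simps ac_simps)

lemma bsubst_lform_eq_0_iff:
  assumes "u \<noteq> v" "normal p" "normal_subspace A"
    and c: "c u = fst (subspace_parametrization u v A)" "c v = snd (subspace_parametrization u v A)"
  shows "bsubst c (lform u v p) = 0 \<longleftrightarrow> meet_line p A = A"
proof (cases A)
  case Plane
  then have "bsubst c (lform u v p) = lform u v p" using c by (simp add: lform_def bsubst_simps)
  then show ?thesis using Plane lform_neq_0[OF assms(1,2)] by simp
next
  case (Line q)
  then have "bsubst c (lform u v p) =
      Const (snd p * fst q - fst p * snd q) * line_coordinate u v q"
    using c by (simp add: lform_def bsubst_simps Const_simps algebra_simps)
  moreover have "line_coordinate u v q \<noteq> 0" by (simp add: line_coordinate_def Var_neq_0)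
  ultimately show ?thesis using Line assms normal_det[of p q] by (auto simp: Const_eq_0_iff)
next
  case Origin
  then show ?thesis using c by (simp add: lform_def bsubst_simps)
qed

definition linear_ideal ::
  "'k::comm_ring_1 plane_subspace \<Rightarrow> 'k plane_subspace \<Rightarrow> 'k bpoly set" where
  "linear_ideal A B = ideal_gen (subspace_forms X0 X1 A \<union> subspace_forms Y0 Y1 B)"

fun parametrization :: "'k::comm_ring_1 plane_subspace \<Rightarrow> 'k plane_subspace \<Rightarrow> var \<Rightarrow> 'k bpoly" where
  "parametrization A B X0 = fst (subspace_parametrization X0 X1 A)"
| "parametrization A B X1 = snd (subspace_parametrization X0 X1 A)"
| "parametrization A B Y0 = fst (subspace_parametrization Y0 Y1 B)"
| "parametrization A B Y1 = snd (subspace_parametrization Y0 Y1 B)"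

lemma is_ideal_linear_ideal: "is_ideal (linear_ideal A B)"
  by (simp add: linear_ideal_def is_ideal_ideal_gen)

lemma linear_ideal_eq_kernel:
  assumes "normal_subspace A" "normal_subspace B"
  shows "linear_ideal A B = {f. bsubst (parametrization A B) f = 0}"
proof
  show "linear_ideal A B \<subseteq> {f. bsubst (parametrization A B) f = 0}"
    unfolding linear_ideal_def
    by (intro ideal_gen_least is_ideal_kernel is_ring_hom_bsubst) (auto intro!: subspace_forms_vanish)
  have "subspace_forms X0 X1 A \<subseteq> linear_ideal A B" "subspace_forms Y0 Y1 B \<subseteq> linear_ideal A B"
    unfolding linear_ideal_def using ideal_gen_superset by blast+
  then have "parametrization A B v - Var v \<in> linear_ideal A B" for v
    using assms by (cases v) (simp_all add: subspace_parametrization_diff_mem is_ideal_linear_ideal)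
  then have "bsubst (parametrization A B) f - f \<in> linear_ideal A B" for f
    by (intro bsubst_diff_mem is_ideal_linear_ideal)
  then show "{f. bsubst (parametrization A B) f = 0} \<subseteq> linear_ideal A B"
    using ideal_diff_iff[OF is_ideal_linear_ideal] ideal_zero[OF is_ideal_linear_ideal] by fastforce
qed

lemma prime_linear_ideal:
  fixes A B :: "'k::field plane_subspace"
  assumes "normal_subspace A" "normal_subspace B" shows "prime_ideal (linear_ideal A B)"
proof -
  have "1 \<notin> linear_ideal A B" by (simp add: linear_ideal_eq_kernel[OF assms] bsubst_simps)
  then have "linear_ideal A B \<noteq> UNIV" by blast
  then show ?thesis
    using is_ideal_linear_ideal[of A B]
    by (auto simp: prime_ideal_def linear_ideal_eq_kernel[OF assms] bsubst_simps)
qed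

lemma lform_mem_linear_ideal_iff:
  assumes "normal p" "normal_subspace A" "normal_subspace B"
  shows "xform p \<in> linear_ideal A B \<longleftrightarrow> meet_line p A = A"
    and "yform p \<in> linear_ideal A B \<longleftrightarrow> meet_line p B = B"
  using assms by (simp_all add: linear_ideal_eq_kernel bsubst_lform_eq_0_iff)

lemma regular_mod_lform:
  assumes "normal p" "normal_subspace A" "normal_subspace B"
  shows "meet_line p A \<noteq> A \<Longrightarrow> regular_mod (linear_ideal A B) (xform p)"
    and "meet_line p B \<noteq> B \<Longrightarrow> regular_mod (linear_ideal A B) (yform p)"
  using assms by (simp_all add: regular_mod_prime prime_linear_ideal lform_mem_linear_ideal_iff)

lemma adjoin_linear_ideal:
  assumes "normal p" "normal_subspace A" "normal_subspace B"
  shows "adjoin (linear_ideal A B) (xform p) = linear_ideal (meet_line p A) B"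
    and "adjoin (linear_ideal A B) (yform p) = linear_ideal A (meet_line p B)"
  using subspace_forms_meet_line[OF assms(1,2), of X0 X1 "subspace_forms Y0 Y1 B"]
    subspace_forms_meet_line[OF assms(1,3), of Y0 Y1 "subspace_forms X0 X1 A"]
  by (simp_all add: linear_ideal_def adjoin_ideal_gen Un_commute)

lemma linear_ideal_Plane_eq_zero: "linear_ideal Plane Plane = {0}"
  by (simp add: linear_ideal_def ideal_gen_empty)

lemma linear_ideal_Origin_eq_irrelevant: "linear_ideal Origin Origin = irrelevant_ideal"
proof -
  have UNIV_eq: "UNIV = {X0, X1, Y0, Y1}" by (auto intro: var.exhaust)
  show ?thesis by (simp add: linear_ideal_def irrelevant_ideal_def UNIV_eq insert_commute)
qed

lemma point_ideal_eq_ideal_gen: "point_ideal P = ideal_gen {xform (fst P), yform (snd P)}"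
  by (simp add: point_ideal_def lform_def split: prod.split)

lemma linear_ideal_Line_eq_point_ideal: "linear_ideal (Line (fst P)) (Line (snd P)) = point_ideal P"
  by (simp add: linear_ideal_def point_ideal_eq_ideal_gen insert_commute)

section \<open>Fat points\<close>

lemma fat_ideal_eq: "fat_ideal m S = (\<Inter>P\<in>S. pair_pow {0} (xform (fst P)) (yform (snd P)) m)"
  by (simp add: fat_ideal_def point_ideal_eq_ideal_gen ideal_pow_pair)

lemma is_ideal_fat_ideal: "is_ideal (fat_ideal m S)"
  unfolding fat_ideal_eq by (intro is_ideal_INT is_ideal_pair_pow)

lemma fat_ideal_mono: "T \<subseteq> S \<Longrightarrow> fat_ideal m S \<subseteq> fat_ideal m T"
  by (auto simp: fat_ideal_def)

lemma points_ideal_eq_fat_ideal: "points_ideal S = fat_ideal 1 S"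
  unfolding points_ideal_def fat_ideal_eq pair_pow_1
  by (simp add: point_ideal_eq_ideal_gen)

lemma fat_ideal_subset_point_ideal:
  assumes "P \<in> S" "m > 0" shows "fat_ideal m S \<subseteq> point_ideal P"
proof -
  have "pair_pow {0} (xform (fst P)) (yform (snd P)) m \<subseteq> point_ideal P"
  proof (rule pair_pow_least)
    have "xform (fst P) \<in> point_ideal P" "yform (snd P) \<in> point_ideal P"
      by (simp_all add: point_ideal_eq_ideal_gen ideal_gen_base)
    moreover show ideal: "is_ideal (point_ideal P)"
      by (simp add: point_ideal_eq_ideal_gen is_ideal_ideal_gen)
    ultimately show "xform (fst P) ^ k * yform (snd P) ^ l \<in> point_ideal P" if "k + l = m" for k l
      using that assms(2) by (cases k; cases l) (auto intro: ideal_mult ideal_mult_right)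
    show "{0} \<subseteq> point_ideal P" using ideal_zero[OF ideal] by simp
  qed
  then show ?thesis using assms(1) by (auto simp: fat_ideal_eq)
qed

lemma is_ideal_irrelevant_ideal: "is_ideal irrelevant_ideal"
  by (simp add: irrelevant_ideal_def is_ideal_ideal_gen)

lemma lform_irrelevant: "lform u v p \<in> irrelevant_ideal"
  unfolding irrelevant_ideal_def
  by (intro lform_mem is_ideal_ideal_gen ideal_gen_base rangeI)

lemma fat_ideal_subset_irrelevant_ideal:
  assumes "S \<noteq> {}" "m > 0" shows "fat_ideal m S \<subseteq> irrelevant_ideal"
proof -
  obtain P where "P \<in> S" using assms(1) by blast
  then have "fat_ideal m S \<subseteq> ideal_gen {xform (fst P), yform (snd P)}"
    using fat_ideal_subset_point_ideal[OF _ assms(2)]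
    by (simp add: point_ideal_eq_ideal_gen)
  also have "\<dots> \<subseteq> irrelevant_ideal"
    by (intro ideal_gen_least) (simp_all add: lform_irrelevant is_ideal_irrelevant_ideal)
  finally show ?thesis .
qed

lemma has_socle_irrelevantI:
  assumes J: "is_ideal J" and "w \<notin> J" "\<And>v. Var v * w \<in> J"
  shows "has_socle irrelevant_ideal J"
proof -
  have "irrelevant_ideal \<subseteq> {a. a * w \<in> J}"
    unfolding irrelevant_ideal_def using assms by (intro ideal_gen_least is_ideal_colon) auto
  then show ?thesis using assms(2) by (auto simp: has_socle_def)
qed

lemma parametrization_in_monomial_span:
  fixes f :: "'k::field bpoly"
  shows "\<exists>d. bsubst (parametrization (Line p) (Line q)) f
    \<in> monomial_span Const (line_coordinate X0 X1 p) (line_coordinate Y0 Y1 q) d"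
proof (induction f rule: bpoly_induct)
  case (Const c)
  then show ?case
    using scaled_monomial_in_monomial_span[OF is_ring_hom_Const, of c _ 0 _ 0] by (auto simp: bsubst_simps)
next
  case (Var v)
  let ?s = "line_coordinate X0 X1 p" and ?t = "line_coordinate Y0 Y1 q"
  have "Const c * ?s \<in> monomial_span Const ?s ?t 1" "Const c * ?t \<in> monomial_span Const ?s ?t 1" for c
    using scaled_monomial_in_monomial_span[OF is_ring_hom_Const, of c ?s 1 ?t 0]
      scaled_monomial_in_monomial_span[OF is_ring_hom_Const, of c ?s 0 ?t 1] by simp_all
  then show ?case by (cases v) (auto simp: bsubst_simps)
next
  case (add f g)
  then show ?case using monomial_span_add[OF is_ring_hom_Const] by (fastforce simp: bsubst_simps)
next
  case (mult f g)
  then show ?case using monomial_span_mult[OF is_ring_hom_Const] by (fastforce simp: bsubst_simps)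
qed

lemma alg_dependent_mod_point_ideal:
  fixes P :: "'k::field point"
  assumes "normal (fst P)" "normal (snd P)"
  shows "alg_dependent_mod Const (point_ideal P) f g h"
proof -
  let ?\<phi> = "bsubst (parametrization (Line (fst P)) (Line (snd P)))"
  let ?V = "monomial_span Const (line_coordinate X0 X1 (fst P)) (line_coordinate Y0 Y1 (snd P))"
  obtain a b c where abc: "?\<phi> f \<in> ?V a" "?\<phi> g \<in> ?V b" "?\<phi> h \<in> ?V c"
    using parametrization_in_monomial_span by metis
  have "?V n \<subseteq> ?V (a + b + c)" if "n \<le> a + b + c" for n
    using that by (rule monomial_span_mono[OF is_ring_hom_Const])
  from abc this[of a] this[of b] this[of c]
  have "?\<phi> f \<in> ?V (a + b + c)" "?\<phi> g \<in> ?V (a + b + c)" "?\<phi> h \<in> ?V (a + b + c)" by auto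
  then have "alg_dependent_mod Const {0} (?\<phi> f) (?\<phi> g) (?\<phi> h)"
    by (rule monomial_span_alg_dependent[OF is_ring_hom_Const])
  then have "alg_dependent_mod Const {a. ?\<phi> a = 0} f g h"
    by (rule alg_dependent_mod_kernel[OF is_ring_hom_bsubst is_ring_hom_Const bsubst_Const])
  then show ?thesis
    using assms by (simp add: linear_ideal_eq_kernel flip: linear_ideal_Line_eq_point_ideal)
qed

lemma power_mem_ideal_pow: "f \<in> I \<Longrightarrow> f ^ n \<in> ideal_pow I n"
proof (induction n)
  case (Suc n)
  then show ?case by (auto simp: ideal_prod_def intro!: ideal_gen_base)
qed simp

lemma ex_normal_avoiding:
  fixes A :: "('k::field \<times> 'k) set"
  assumes "infinite (UNIV :: 'k set)" "finite A"
  obtains c where "normal c" "c \<notin> A"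
proof -
  have "infinite (range (\<lambda>c :: 'k. (c, 1 :: 'k)))"
    using assms(1) by (subst finite_image_iff) (auto simp: inj_on_def)
  then have "\<not> range (\<lambda>c :: 'k. (c, 1 :: 'k)) \<subseteq> A" using assms(2) finite_subset by blast
  then obtain c where "(c, 1) \<notin> A" by blast
  then show ?thesis using that[of "(c, 1)"] by (simp add: normal_def)
qed

abbreviation columns :: "('a \<times> 'b) set \<Rightarrow> 'a set" where "columns S \<equiv> fst ` S"
abbreviation rows :: "('a \<times> 'b) set \<Rightarrow> 'b set" where "rows S \<equiv> snd ` S"

locale normal_points =
  fixes S :: "'k::field point set"
  assumes finite_points: "finite S"
    and normal_fst: "P \<in> S \<Longrightarrow> normal (fst P)"
    and normal_snd: "P \<in> S \<Longrightarrow> normal (snd P)"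
begin

lemma finite_columns: "finite (columns S)"
  and finite_rows: "finite (rows S)"
  using finite_points by simp_all

lemma normal_column: "p \<in> columns S \<Longrightarrow> normal p"
  and normal_row: "q \<in> rows S \<Longrightarrow> normal q"
  using normal_fst normal_snd by auto

lemma alg_dependent_mod_fat_ideal: "alg_dependent_mod Const (fat_ideal m S) f g h"
proof -
  have "\<exists>Q. Q \<noteq> 0 \<and> eval3 Const f g h Q \<in> point_ideal P" if "P \<in> S" for P
    using alg_dependent_mod_point_ideal[OF normal_fst[OF that] normal_snd[OF that]]
    by (simp add: alg_dependent_mod_def)
  then obtain Q where Q: "\<And>P. P \<in> S \<Longrightarrow> Q P \<noteq> 0"
    "\<And>P. P \<in> S \<Longrightarrow> eval3 Const f g h (Q P) \<in> point_ideal P" by metis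
  have "(\<Prod>P\<in>S. eval3 Const f g h (Q P) ^ m) \<in> fat_ideal m S"
    unfolding fat_ideal_def
  proof
    fix P assume P: "P \<in> S"
    have "is_ideal (ideal_pow (point_ideal P) m)"
      by (simp add: point_ideal_eq_ideal_gen ideal_pow_pair is_ideal_pair_pow)
    then show "(\<Prod>P\<in>S. eval3 Const f g h (Q P) ^ m) \<in> ideal_pow (point_ideal P) m"
      using finite_points P by (rule prod_mem_ideal) (rule power_mem_ideal_pow[OF Q(2)[OF P]])
  qed
  then have "eval3 Const f g h (\<Prod>P\<in>S. Q P ^ m) \<in> fat_ideal m S"
    by (simp add: ring_hom_prod ring_hom_power is_ring_hom_eval3 is_ring_hom_Const)
  moreover have "(\<Prod>P\<in>S. Q P ^ m) \<noteq> 0" using Q(1) finite_points by simp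
  ultimately show ?thesis by (auto simp: alg_dependent_mod_def)
qed

lemma depth_fat_ideal_le_two: "depth_quot (fat_ideal m S) \<le> 2"
  using is_ring_hom_Const alg_dependent_mod_fat_ideal is_ideal_fat_ideal by (rule depth_quot_le_two)

lemma krull_dim_fat_ideal:
  assumes "S \<noteq> {}" "m > 0" shows "krull_dim_quot (fat_ideal m S) = 2"
proof (rule antisym)
  show "krull_dim_quot (fat_ideal m S) \<le> 2"
    using is_ring_hom_Const alg_dependent_mod_fat_ideal by (rule krull_dim_quot_le_two)
next
  obtain P where P: "P \<in> S" using assms by blast
  define Q where "Q i = (case i of 0 \<Rightarrow> linear_ideal (Line (fst P)) (Line (snd P))
     | Suc 0 \<Rightarrow> linear_ideal (Line (fst P)) Origin | _ \<Rightarrow> linear_ideal Origin Origin)" for i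
  note normals = normal_fst[OF P] normal_snd[OF P]
  obtain p q where pq: "normal p" "normal q" "p \<noteq> fst P" "q \<noteq> snd P" by (metis ex_normal_neq)
  have "fat_ideal m S \<subseteq> Q 0"
    using fat_ideal_subset_point_ideal[OF P assms(2)]
    by (simp add: Q_def linear_ideal_Line_eq_point_ideal)
  moreover have "Q 1 = adjoin (Q 0) (yform q)" "Q 2 = adjoin (Q 1) (xform p)"
    using pq normals by (simp_all add: Q_def adjoin_linear_ideal numeral_2_eq_2)
  then have "Q 0 \<subseteq> Q 1" "Q 1 \<subseteq> Q 2" using adjoin_superset by simp_all
  moreover have "yform q \<in> Q 1 - Q 0" "xform p \<in> Q 2 - Q 1"
    using pq normals by (simp_all add: Q_def lform_mem_linear_ideal_iff numeral_2_eq_2)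
  moreover have "prime_ideal (Q 0)" "prime_ideal (Q 1)" "prime_ideal (Q 2)"
    using normals by (simp_all add: Q_def prime_linear_ideal numeral_2_eq_2)
  ultimately have "(\<forall>i\<le>2. prime_ideal (Q i) \<and> fat_ideal m S \<subseteq> Q i) \<and> (\<forall>i<2. Q i \<subset> Q (Suc i))"
    by (auto simp: numeral_2_eq_2 le_Suc_eq less_Suc_eq)
  then have "enat 2 \<le> krull_dim_quot (fat_ideal m S)"
    unfolding krull_dim_quot_def by (intro Sup_upper) blast
  then show "2 \<le> krull_dim_quot (fat_ideal m S)" by (simp add: numeral_eq_enat)
qed

lemma regular_mod_fat_ideal_xform:
  assumes c: "normal c" "c \<notin> columns S"
  shows "regular_mod (fat_ideal m S) (xform c)"
  unfolding fat_ideal_eq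
proof (intro regular_mod_INT regular_mod_pair_pow is_ideal_zero)
  fix P assume P: "P \<in> S"
  then have "c \<noteq> fst P" using c(2) by blast
  then show "regular_mod {0} (xform (fst P))" "regular_mod (adjoin {0} (xform (fst P))) (yform (snd P))"
    "regular_mod (adjoin (adjoin {0} (xform (fst P))) (yform (snd P))) (xform c)"
    using c(1) normal_fst[OF P] normal_snd[OF P]
    by (simp_all add: adjoin_linear_ideal regular_mod_lform flip: linear_ideal_Plane_eq_zero)
qed

end

section \<open>Grids\<close>

definition grid :: "('a \<times> 'b) set \<Rightarrow> bool" where
  "grid S \<longleftrightarrow> columns S \<times> rows S \<subseteq> S"

lemma grid_eq: "grid S \<Longrightarrow> S = columns S \<times> rows S"
  by (force simp: grid_def)

lemma regular_mod_xform_prod: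
  assumes "normal_subspace A" "normal_subspace B"
    and "\<And>p. p \<in> C \<Longrightarrow> normal p" "\<And>p. p \<in> C \<Longrightarrow> meet_line p A \<noteq> A"
  shows "regular_mod (linear_ideal A B) (\<Prod>p\<in>C. xform p)"
  using assms by (intro regular_mod_prod regular_mod_lform) auto

lemma regular_mod_adjoin_xform_prod_yform:
  assumes "normal_subspace A" "normal_subspace B"
    and "\<And>p. p \<in> C \<Longrightarrow> normal p" "\<And>p. p \<in> C \<Longrightarrow> meet_line p A \<noteq> A"
    and q: "normal q" "meet_line q B \<noteq> B"
  shows "regular_mod (adjoin (linear_ideal A B) (\<Prod>p\<in>C. xform p)) (yform q)"
proof (rule regular_mod_adjoin_swap[OF is_ideal_linear_ideal])
  show "regular_mod (linear_ideal A B) (yform q)" using assms by (intro regular_mod_lform)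
  show "regular_mod (adjoin (linear_ideal A B) (yform q)) (\<Prod>p\<in>C. xform p)"
    unfolding adjoin_linear_ideal(2)[OF q(1) assms(1,2)]
    using assms by (intro regular_mod_xform_prod normal_meet_line)
qed

lemma regular_mod_yform_xform:
  assumes "normal p" "normal q"
  shows "regular_mod {0} (yform q)" "regular_mod (adjoin {0} (yform q)) (xform p)"
  using assms
  by (simp_all add: adjoin_linear_ideal regular_mod_lform flip: linear_ideal_Plane_eq_zero)

lemma fat_ideal_row:
  assumes "finite A" "\<And>p. p \<in> A \<Longrightarrow> normal p" "normal q"
  shows "fat_ideal m (A \<times> {q}) \<subseteq> pair_pow {0} (\<Prod>p\<in>A. xform p) (yform q) m"
proof
  fix f assume f: "f \<in> fat_ideal m (A \<times> {q})"
  have "f \<in> pair_pow {0} (yform q) (\<Prod>p\<in>A. xform p) m"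
  proof (rule mem_pair_pow_prod[OF is_ideal_zero \<open>finite A\<close>])
    show "regular_mod {0} (yform q)" by (rule regular_mod_yform_xform[OF assms(3,3)])
    show "regular_mod (adjoin {0} (yform q)) (xform p)" if "p \<in> A" for p
      using assms(2)[OF that] assms(3) by (rule regular_mod_yform_xform)
    show "regular_mod (adjoin (adjoin {0} (yform q)) (xform r)) (xform p)"
      if "p \<in> A" "r \<in> A" "p \<noteq> r" for p r
      using assms that
      by (simp add: adjoin_linear_ideal regular_mod_lform flip: linear_ideal_Plane_eq_zero)
    show "f \<in> pair_pow {0} (yform q) (xform p) m" if "p \<in> A" for p
      using f that by (auto simp: fat_ideal_eq pair_pow_commute[of _ "yform q"])
  qed
  then show "f \<in> pair_pow {0} (\<Prod>p\<in>A. xform p) (yform q) m" by (simp add: pair_pow_commute)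
qed

lemma fat_ideal_grid:
  assumes fin: "finite A" "finite B"
    and normal: "\<And>p. p \<in> A \<Longrightarrow> normal p" "\<And>q. q \<in> B \<Longrightarrow> normal q"
  shows "fat_ideal m (A \<times> B) = pair_pow {0} (\<Prod>p\<in>A. xform p) (\<Prod>q\<in>B. yform q) m"
    (is "_ = pair_pow _ ?F ?G _")
proof
  show "fat_ideal m (A \<times> B) \<subseteq> pair_pow {0} ?F ?G m"
  proof
    fix f assume f: "f \<in> fat_ideal m (A \<times> B)"
    show "f \<in> pair_pow {0} ?F ?G m"
    proof (rule mem_pair_pow_prod[OF is_ideal_zero \<open>finite B\<close>])
      show "regular_mod {0} ?F"
        unfolding linear_ideal_Plane_eq_zero[symmetric] using normal
        by (intro regular_mod_xform_prod) simp_all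
      show "regular_mod (adjoin {0} ?F) (yform q)" if "q \<in> B" for q
        unfolding linear_ideal_Plane_eq_zero[symmetric]
        using normal that by (intro regular_mod_adjoin_xform_prod_yform) simp_all
      show "regular_mod (adjoin (adjoin {0} ?F) (yform p)) (yform q)" if "q \<in> B" "p \<in> B" "q \<noteq> p" for p q
        unfolding linear_ideal_Plane_eq_zero[symmetric] adjoin_commute[of _ ?F]
        using normal that
        by (subst adjoin_linear_ideal) (simp_all add: regular_mod_adjoin_xform_prod_yform)
      show "f \<in> pair_pow {0} ?F (yform q) m" if "q \<in> B" for q
        using f that fat_ideal_mono[of "A \<times> {q}" "A \<times> B" m] fat_ideal_row[of A q m] fin normal by auto
    qed
  qed
  have "pair_pow {0} ?F ?G m \<subseteq> pair_pow {0} (xform p) (yform q) m" if "p \<in> A" "q \<in> B" for p q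
    using fin that by (intro pair_pow_dvd_subset dvd_prodI)
  then show "pair_pow {0} ?F ?G m \<subseteq> fat_ideal m (A \<times> B)"
    unfolding fat_ideal_eq by (intro INF_greatest) (simp add: mem_Times_iff)
qed

lemma regular_mod_fat_ideal_grid:
  assumes fin: "finite A" "finite B"
    and normal: "\<And>p. p \<in> A \<Longrightarrow> normal p" "\<And>q. q \<in> B \<Longrightarrow> normal q"
    and c: "normal c" "c \<notin> A" and d: "normal d" "d \<notin> B"
  shows "regular_mod (adjoin (fat_ideal m (A \<times> B)) (xform c)) (yform d)"
proof -
  let ?F = "\<Prod>p\<in>A. xform p" and ?G = "\<Prod>q\<in>B. yform q" and ?L = "linear_ideal (Line c) Plane"
  have "adjoin (fat_ideal m (A \<times> B)) (xform c) = pair_pow ?L ?F ?G m"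
    using c by (simp add: fat_ideal_grid fin normal adjoin_pair_pow adjoin_linear_ideal
        flip: linear_ideal_Plane_eq_zero)
  moreover have "regular_mod (pair_pow ?L ?F ?G m) (yform d)"
  proof (rule regular_mod_pair_pow[OF is_ideal_linear_ideal])
    have misses: "meet_line p (Line c) \<noteq> Line c" if "p \<in> A" for p using that c by auto
    show "regular_mod ?L ?F" using c normal misses by (intro regular_mod_xform_prod) auto
    have regular_yform: "regular_mod (adjoin ?L ?F) (yform q)" if "normal q" for q
      using c normal misses that by (intro regular_mod_adjoin_xform_prod_yform) auto
    then show "regular_mod (adjoin ?L ?F) ?G" using normal by (intro regular_mod_prod) auto
    show "regular_mod (adjoin (adjoin ?L ?F) ?G) (yform d)"
    proof (rule regular_mod_adjoin_swap[OF is_ideal_adjoin regular_yform[OF d(1)]])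
      have "regular_mod (adjoin (linear_ideal (Line c) (Line d)) ?F) (yform q)" if "q \<in> B" for q
        using c d normal misses that by (intro regular_mod_adjoin_xform_prod_yform) auto
      then show "regular_mod (adjoin (adjoin ?L ?F) (yform d)) ?G"
        using c d by (simp add: adjoin_commute[of _ ?F] adjoin_linear_ideal regular_mod_prod)
    qed
  qed
  ultimately show ?thesis by simp
qed

context normal_points
begin

lemma depth_fat_ideal_grid:
  assumes inf: "infinite (UNIV :: 'k set)" and "grid S" "S \<noteq> {}" "m > 0"
  shows "depth_quot (fat_ideal m S) = 2"
proof (rule antisym[OF depth_fat_ideal_le_two])
  obtain c where c: "normal c" "c \<notin> columns S" using ex_normal_avoiding[OF inf finite_columns] .
  obtain d where d: "normal d" "d \<notin> rows S" using ex_normal_avoiding[OF inf finite_rows] .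
  let ?J = "adjoin (adjoin (fat_ideal m S) (xform c)) (yform d)"
  have "regular_mod (adjoin (fat_ideal m (columns S \<times> rows S)) (xform c)) (yform d)"
    by (rule regular_mod_fat_ideal_grid[OF finite_columns finite_rows normal_column normal_row c d])
  then have "regular_mod (adjoin (fat_ideal m S) (xform c)) (yform d)"
    using grid_eq[OF \<open>grid S\<close>] by simp
  moreover have "?J \<subseteq> irrelevant_ideal"
    using fat_ideal_subset_irrelevant_ideal assms
    by (intro adjoin_least lform_irrelevant is_ideal_irrelevant_ideal) auto
  then have "?J \<noteq> UNIV"
    using prime_linear_ideal[of Origin "Origin :: 'k plane_subspace"]
    by (auto simp: linear_ideal_Origin_eq_irrelevant prime_ideal_def)
  ultimately show "2 \<le> depth_quot (fat_ideal m S)"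
    using depth_quot_ge_two[OF is_ideal_fat_ideal lform_irrelevant lform_irrelevant
        regular_mod_fat_ideal_xform[OF c]] by blast
qed

end

section \<open>Bihomogeneous components\<close>

lemma bihomogeneous_mult:
  assumes "bihomogeneous a b f" "bihomogeneous a' b' g"
  shows "bihomogeneous (a + a') (b + b') (f * g)"
  unfolding bihomogeneous_def
proof
  fix \<mu> assume "\<mu> \<in> Poly_Mapping.keys (f * g)"
  then obtain \<nu> \<rho> where "\<mu> = \<nu> + \<rho>" "\<nu> \<in> Poly_Mapping.keys f" "\<rho> \<in> Poly_Mapping.keys g"
    using keys_mult[of f g] by blast
  then show "Poly_Mapping.lookup \<mu> X0 + Poly_Mapping.lookup \<mu> X1 = a + a' \<and>
      Poly_Mapping.lookup \<mu> Y0 + Poly_Mapping.lookup \<mu> Y1 = b + b'"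
    using assms by (auto simp: bihomogeneous_def lookup_add)
qed

lemma bihomogeneous_one: "bihomogeneous 0 0 1"
  by (simp add: bihomogeneous_def)

lemma bihomogeneous_power: "bihomogeneous a b f \<Longrightarrow> bihomogeneous (n * a) (n * b) (f ^ n)"
  by (induction n) (auto intro: bihomogeneous_one bihomogeneous_mult)

lemma bihomogeneous_prod:
  "(\<And>i. i \<in> A \<Longrightarrow> bihomogeneous (a i) (b i) (f i)) \<Longrightarrow>
    bihomogeneous (\<Sum>i\<in>A. a i) (\<Sum>i\<in>A. b i) (\<Prod>i\<in>A. f i)"
  by (induction A rule: infinite_finite_induct) (auto intro: bihomogeneous_one bihomogeneous_mult)

lemma bihomogeneous_diff:
  "bihomogeneous a b f \<Longrightarrow> bihomogeneous a b g \<Longrightarrow> bihomogeneous a b (f - g)"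
  by (auto simp: bihomogeneous_def in_keys_iff lookup_minus)

lemma bihomogeneous_single:
  "bihomogeneous (Poly_Mapping.lookup \<mu> X0 + Poly_Mapping.lookup \<mu> X1)
     (Poly_Mapping.lookup \<mu> Y0 + Poly_Mapping.lookup \<mu> Y1) (Poly_Mapping.single \<mu> c)"
  by (simp add: bihomogeneous_def)

lemma bihomogeneous_Const_Var:
  "bihomogeneous (if v \<in> {X0, X1} then 1 else 0) (if v \<in> {X0, X1} then 0 else 1) (Const c * Var v)"
  using bihomogeneous_single[of "Poly_Mapping.single v 1" c]
  by (cases v) (auto simp: Const_def Var_def mult_single lookup_single)

lemma bihomogeneous_xform: "bihomogeneous 1 0 (xform p)"
  using bihomogeneous_Const_Var[of X0 "snd p"] bihomogeneous_Const_Var[of X1 "fst p"]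
  by (auto simp: lform_def intro: bihomogeneous_diff)

lemma bihomogeneous_yform: "bihomogeneous 0 1 (yform p)"
  using bihomogeneous_Const_Var[of Y0 "snd p"] bihomogeneous_Const_Var[of Y1 "fst p"]
  by (auto simp: lform_def intro: bihomogeneous_diff)

lemma bihomogeneous_xform_power: "bihomogeneous n 0 (xform p ^ n)"
  using bihomogeneous_power[OF bihomogeneous_xform, of n p] by simp

lemma bihomogeneous_xform_prod_power: "bihomogeneous (\<Sum>p\<in>A. e p) 0 (\<Prod>p\<in>A. xform p ^ e p)"
  using bihomogeneous_prod[of A e "\<lambda>_. 0" "\<lambda>p. xform p ^ e p"] bihomogeneous_xform_power by auto

lemma bihomogeneous_xform_prod: "bihomogeneous (card A) 0 (\<Prod>p\<in>A. xform p)"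
  using bihomogeneous_xform_prod_power[where e = "\<lambda>_. 1"] by simp

lemma bihomogeneous_yform_prod: "bihomogeneous 0 (card B) (\<Prod>q\<in>B. yform q)"
  using bihomogeneous_prod[of B "\<lambda>_. 0" "\<lambda>_. 1" yform] bihomogeneous_yform by auto

definition component :: "nat \<Rightarrow> nat \<Rightarrow> 'k::comm_ring_1 bpoly \<Rightarrow> 'k bpoly" where
  "component a b f = Poly_Mapping.mapp (\<lambda>\<mu> c. if Poly_Mapping.lookup \<mu> X0 + Poly_Mapping.lookup \<mu> X1 = a
     \<and> Poly_Mapping.lookup \<mu> Y0 + Poly_Mapping.lookup \<mu> Y1 = b then c else 0) f"

lemma lookup_component:
  "Poly_Mapping.lookup (component a b f) \<mu> =
    (if Poly_Mapping.lookup \<mu> X0 + Poly_Mapping.lookup \<mu> X1 = a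
     \<and> Poly_Mapping.lookup \<mu> Y0 + Poly_Mapping.lookup \<mu> Y1 = b then Poly_Mapping.lookup f \<mu> else 0)"
  by (auto simp: component_def lookup_mapp when_def in_keys_iff)

lemma component_add: "component a b (f + g) = component a b f + component a b g"
  by (rule poly_mapping_eqI) (simp add: lookup_component lookup_add)

lemma component_diff: "component a b (f - g) = component a b f - component a b g"
  by (rule poly_mapping_eqI) (simp add: lookup_component lookup_minus)

lemma bihomogeneous_component: "bihomogeneous a b (component a b f)"
  by (auto simp: bihomogeneous_def in_keys_iff lookup_component split: if_splits)

lemma component_bihomogeneous:
  assumes "bihomogeneous a' b' f"
  shows "component a b f = (if a = a' \<and> b = b' then f else 0)"
proof (rule poly_mapping_eqI)
  fix \<mu>
  show "Poly_Mapping.lookup (component a b f) \<mu> =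
      Poly_Mapping.lookup (if a = a' \<and> b = b' then f else 0) \<mu>"
    using assms by (cases "\<mu> \<in> Poly_Mapping.keys f")
      (auto simp: lookup_component bihomogeneous_def in_keys_iff)
qed

lemma component_mult:
  assumes g: "bihomogeneous a' b' g"
  shows "component a b (g * f) = (if a' \<le> a \<and> b' \<le> b then g * component (a - a') (b - b') f else 0)"
proof (induction f rule: poly_mapping_single_induct)
  case (single \<mu> c)
  note hom = bihomogeneous_single[of \<mu> c]
  show ?case
    using component_bihomogeneous[OF bihomogeneous_mult[OF g hom], of a b]
      component_bihomogeneous[OF hom, of "a - a'" "b - b'"]
    by auto
qed (auto simp: distrib_left component_add)

lemma dvd_component: "bihomogeneous a' b' g \<Longrightarrow> g dvd f \<Longrightarrow> g dvd component a b f"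
  by (auto simp: component_mult elim!: dvdE)

lemma bihomogeneous_eq_0:
  assumes "bihomogeneous a b f" "bihomogeneous a' b' g" "g dvd f" "\<not> (a' \<le> a \<and> b' \<le> b)"
  shows "f = 0"
  using component_bihomogeneous[OF assms(1), of a b] component_mult[OF assms(2)] assms(3,4)
  by (auto simp: dvd_def)

lemma bihomogeneous_cofactor:
  assumes "bihomogeneous a b f" "bihomogeneous a' b' g" "g dvd f" "a' \<le> a" "b' \<le> b"
  obtains h where "bihomogeneous (a - a') (b - b') h" "f = g * h"
proof -
  obtain h where h: "f = g * h" using assms(3) by (rule dvdE)
  then have "f = g * component (a - a') (b - b') h"
    using component_bihomogeneous[OF assms(1), of a b] component_mult[OF assms(2)] assms(4,5) by simp
  then show ?thesis using that bihomogeneous_component by blast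
qed

lemma bihomogeneous_dvd_of_mem_adjoin:
  assumes f: "bihomogeneous a b f" and u: "bihomogeneous a' b' u" and v: "bihomogeneous c d v"
    and mem: "f \<in> adjoin (adjoin {0} u) v" and small: "\<not> (c \<le> a \<and> d \<le> b)"
  shows "u dvd f"
proof -
  obtain r where "u dvd f - v * r"
    using mem by (auto simp: mem_adjoin_iff[OF is_ideal_adjoin] mem_adjoin_zero_iff)
  then have "u dvd component a b (f - v * r)" by (rule dvd_component[OF u])
  also have "component a b (f - v * r) = f"
    using component_bihomogeneous[OF f, of a b] component_mult[OF v] small
    by (auto simp: component_diff)
  finally show ?thesis .
qed

definition graded_ideal :: "'k::comm_ring_1 bpoly set \<Rightarrow> bool" where
  "graded_ideal J \<longleftrightarrow> (\<forall>f\<in>J. \<forall>a b. component a b f \<in> J)"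

lemma graded_ideal_gen:
  assumes "\<And>g. g \<in> G \<Longrightarrow> \<exists>a b. bihomogeneous a b g"
  shows "graded_ideal (ideal_gen G)"
proof -
  note ideal = is_ideal_ideal_gen[of G]
  let ?C = "{f. \<forall>a b. component a b f \<in> ideal_gen G}"
  have "r * f \<in> ?C" if "f \<in> ?C" for r f
  proof (induction r rule: poly_mapping_single_induct)
    case (single \<mu> c)
    then show ?case
      using that ideal_mult[OF ideal] ideal_zero[OF ideal]
      by (simp add: component_mult[OF bihomogeneous_single])
  qed (simp add: distrib_right component_add ideal_add[OF ideal])
  then have "is_ideal ?C"
    using ideal_zero[OF ideal] ideal_add[OF ideal] component_mult[OF bihomogeneous_one, of _ _ 0]
    by (auto simp: is_ideal_def component_add component_bihomogeneous[of 0 0 0] bihomogeneous_def)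
  moreover have "G \<subseteq> ?C"
  proof clarify
    fix g a b assume "g \<in> G"
    then show "component a b g \<in> ideal_gen G"
      using assms[of g] ideal_zero[OF ideal] ideal_gen_base[of g G]
      by (auto simp: component_bihomogeneous)
  qed
  ultimately have "ideal_gen G \<subseteq> ?C" by (intro ideal_gen_least)
  then show ?thesis by (auto simp: graded_ideal_def)
qed

lemma graded_fat_ideal: "graded_ideal (fat_ideal m S)"
proof -
  have "graded_ideal (pair_pow {0} (xform p) (yform q) m)" for p q :: "'a \<times> 'a"
    unfolding pair_pow_def
  proof (rule graded_ideal_gen)
    fix g assume "g \<in> {0} \<union> {xform p ^ k * yform q ^ l | k l. k + l = m}"
    then consider (zero) "g = 0" | (monomial) k l where "g = xform p ^ k * yform q ^ l" by blast
    then show "\<exists>a b. bihomogeneous a b g"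
    proof cases
      case zero
      then show ?thesis by (simp add: bihomogeneous_def)
    next
      case monomial
      then show ?thesis
        using bihomogeneous_mult bihomogeneous_power bihomogeneous_xform bihomogeneous_yform by blast
    qed
  qed
  then show ?thesis by (simp add: graded_ideal_def fat_ideal_eq)
qed

section \<open>Complete intersections are grids\<close>

lemma bsubst_cong_x:
  "bihomogeneous a 0 F \<Longrightarrow> c X0 = c' X0 \<Longrightarrow> c X1 = c' X1 \<Longrightarrow> bsubst c F = bsubst c' F"
  unfolding bsubst_def by (rule sum.cong) (auto simp: bihomogeneous_def)

lemma bsubst_cong_y:
  "bihomogeneous 0 b G \<Longrightarrow> c Y0 = c' Y0 \<Longrightarrow> c Y1 = c' Y1 \<Longrightarrow> bsubst c G = bsubst c' G"
  unfolding bsubst_def by (rule sum.cong) (auto simp: bihomogeneous_def)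

lemma mem_linear_ideal_cong_x:
  assumes "bihomogeneous a 0 F" "normal_subspace A" "normal_subspace B" "normal_subspace B'"
  shows "F \<in> linear_ideal A B \<longleftrightarrow> F \<in> linear_ideal A B'"
  using bsubst_cong_x[OF assms(1), of "parametrization A B" "parametrization A B'"] assms
  by (simp add: linear_ideal_eq_kernel)

lemma mem_linear_ideal_cong_y:
  assumes "bihomogeneous 0 b G" "normal_subspace A" "normal_subspace A'" "normal_subspace B"
  shows "G \<in> linear_ideal A B \<longleftrightarrow> G \<in> linear_ideal A' B"
  using bsubst_cong_y[OF assms(1), of "parametrization A B" "parametrization A' B"] assms
  by (simp add: linear_ideal_eq_kernel)

context normal_points
begin

lemma points_ideal_subset_imp_mem:
  assumes "normal p" "normal q" and sub: "points_ideal S \<subseteq> linear_ideal (Line p) (Line q)"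
  shows "(p, q) \<in> S"
proof -
  define h where "h R = (if fst R = p then yform (snd R) else xform (fst R))" for R :: "'k point"
  have mem: "h R \<in> point_ideal R" for R
    by (simp add: h_def point_ideal_eq_ideal_gen ideal_gen_base)
  have "(\<Prod>R\<in>S. h R) \<in> points_ideal S"
    unfolding points_ideal_def
  proof
    fix R assume "R \<in> S"
    then show "(\<Prod>R\<in>S. h R) \<in> point_ideal R"
      using finite_points mem
      by (intro prod_mem_ideal[of _ S R]) (simp_all add: point_ideal_eq_ideal_gen is_ideal_ideal_gen)
  qed
  moreover have "prime_ideal (linear_ideal (Line p) (Line q))"
    using assms by (simp add: prime_linear_ideal)
  ultimately obtain R where R: "R \<in> S" "h R \<in> linear_ideal (Line p) (Line q)"
    using prime_ideal_prod[OF _ finite_points] sub by blast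
  have "h R \<in> linear_ideal (Line p) (Line q) \<longleftrightarrow> R = (p, q)"
    using assms normal_fst[OF R(1)] normal_snd[OF R(1)]
    by (cases R) (auto simp: h_def lform_mem_linear_ideal_iff)
  then show ?thesis using R by simp
qed

lemma complete_intersection_iff_grid: "complete_intersection S \<longleftrightarrow> grid S"
proof
  assume "grid S"
  have "points_ideal S = fat_ideal 1 (columns S \<times> rows S)"
    using grid_eq[OF \<open>grid S\<close>] by (simp add: points_ideal_eq_fat_ideal)
  also have "\<dots> = ideal_gen {\<Prod>p\<in>columns S. xform p, \<Prod>q\<in>rows S. yform q}"
    by (simp only: fat_ideal_grid finite_columns finite_rows normal_column normal_row pair_pow_1)
  finally show "complete_intersection S"
    unfolding complete_intersection_def using bihomogeneous_xform_prod bihomogeneous_yform_prod by blast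
next
  assume "complete_intersection S"
  then obtain a b F G where F: "bihomogeneous a 0 F" and G: "bihomogeneous 0 b G"
    and eq: "points_ideal S = ideal_gen {F, G}"
    by (auto simp: complete_intersection_def)
  have mem: "f \<in> linear_ideal (Line (fst P)) (Line (snd P))" if "f \<in> {F, G}" "P \<in> S" for f P
    using that ideal_gen_base[of f "{F, G}"]
    by (auto simp: points_ideal_def linear_ideal_Line_eq_point_ideal simp flip: eq)
  have "(fst P, snd Q) \<in> S" if P: "P \<in> S" and Q: "Q \<in> S" for P Q
  proof (rule points_ideal_subset_imp_mem[OF normal_fst[OF P] normal_snd[OF Q]])
    note normals = normal_fst[OF P] normal_snd[OF P] normal_fst[OF Q] normal_snd[OF Q]
    have "F \<in> linear_ideal (Line (fst P)) (Line (snd Q))"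
      using mem[of F P] P normals
        mem_linear_ideal_cong_x[OF F, of "Line (fst P)" "Line (snd P)" "Line (snd Q)"]
      by simp
    moreover have "G \<in> linear_ideal (Line (fst P)) (Line (snd Q))"
      using mem[of G Q] Q normals
        mem_linear_ideal_cong_y[OF G, of "Line (fst Q)" "Line (fst P)" "Line (snd Q)"]
      by simp
    ultimately show "points_ideal S \<subseteq> linear_ideal (Line (fst P)) (Line (snd Q))"
      unfolding eq by (intro ideal_gen_least is_ideal_linear_ideal) simp
  qed
  then show "grid S" unfolding grid_def by blast
qed

end

section \<open>Fat points off a grid\<close>

definition full_rows :: "('a \<times> 'b) set \<Rightarrow> 'b set" where
  "full_rows S = {q \<in> rows S. \<forall>p\<in>columns S. (p, q) \<in> S}"

definition column_order :: "nat \<Rightarrow> ('a \<times> 'b) set \<Rightarrow> 'a \<Rightarrow> nat" where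
  "column_order m S p = (if \<forall>q. (p, q) \<in> S \<longrightarrow> q \<in> full_rows S then m - 1 else m)"

definition cofactor_degree :: "nat \<Rightarrow> ('a \<times> 'b) set \<Rightarrow> nat" where
  "cofactor_degree m S = (\<Sum>p\<in>columns S. column_order m S p)"

lemma cofactor_degree_le: "cofactor_degree m S \<le> m * card (columns S)"
proof -
  have "cofactor_degree m S \<le> (\<Sum>p\<in>columns S. m)"
    unfolding cofactor_degree_def by (intro sum_mono) (simp add: column_order_def)
  then show ?thesis by (simp add: mult.commute)
qed

lemma cofactor_degree_not_grid:
  assumes fin: "finite S" and m: "m \<ge> 2" and "\<not> grid S"
  shows "(\<Sum>p\<in>columns S. m - 1) < cofactor_degree m S"
    and "q \<in> rows S - full_rows S \<Longrightarrow> (\<Sum>p | (p, q) \<in> S. m) < cofactor_degree m S"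
proof -
  obtain P Q where PQ: "P \<in> S" "Q \<in> S" "(fst P, snd Q) \<notin> S"
    using assms(3) by (auto simp: grid_def)
  then have "snd Q \<notin> full_rows S" by (auto simp: full_rows_def)
  then have "column_order m S (fst Q) = m" using PQ by (auto simp: column_order_def)
  moreover have ge: "m - 1 \<le> column_order m S p" for p by (simp add: column_order_def)
  ultimately show "(\<Sum>p\<in>columns S. m - 1) < cofactor_degree m S"
    unfolding cofactor_degree_def
    using fin m PQ(2) by (intro sum_strict_mono_ex1) (auto intro!: bexI[of _ Q])
  assume q: "q \<in> rows S - full_rows S"
  let ?C = "{p. (p, q) \<in> S}"
  have "?C \<subseteq> columns S" by force
  then have "cofactor_degree m S =
      (\<Sum>p\<in>?C. column_order m S p) + (\<Sum>p\<in>columns S - ?C. column_order m S p)"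
    using fin by (simp add: cofactor_degree_def sum.subset_diff add.commute)
  moreover have "(\<Sum>p\<in>?C. column_order m S p) = (\<Sum>p\<in>?C. m)"
    using q by (intro sum.cong) (auto simp: column_order_def)
  moreover obtain p where p: "p \<in> columns S - ?C" using q by (auto simp: full_rows_def)
  then have "column_order m S p \<le> (\<Sum>p\<in>columns S - ?C. column_order m S p)"
    using fin by (intro member_le_sum) auto
  ultimately show "(\<Sum>p\<in>?C. m) < cofactor_degree m S" using ge[of p] m by linarith
qed

lemma lform_prod_power_dvd:
  assumes uv: "(u, v) \<in> {(X0, X1), (Y0, Y1)}" and "finite A" and normal: "\<And>p. p \<in> A \<Longrightarrow> normal p"
    and dvd: "\<And>p. p \<in> A \<Longrightarrow> lform u v p ^ e p dvd f"
  shows "(\<Prod>p\<in>A. lform u v p ^ e p) dvd f"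
proof -
  have "f \<in> adjoin {0} (\<Prod>p\<in>A. lform u v p ^ e p)"
  proof (rule mem_adjoin_prod_power[OF is_ideal_zero \<open>finite A\<close>])
    show "regular_mod {0} (lform u v p)" if "p \<in> A" for p
      using uv normal[OF that]
      by (auto simp: regular_mod_lform simp flip: linear_ideal_Plane_eq_zero)
    show "regular_mod (adjoin {0} (lform u v q)) (lform u v p)" if "p \<in> A" "q \<in> A" "p \<noteq> q" for p q
      using uv normal[OF that(1)] normal[OF that(2)] that(3)
      by (auto simp: adjoin_linear_ideal regular_mod_lform simp flip: linear_ideal_Plane_eq_zero)
  qed (simp add: mem_adjoin_zero_iff dvd)
  then show ?thesis by (simp add: mem_adjoin_zero_iff)
qed

lemma forms_prod_mem_fat_ideal:
  assumes fin: "finite A" "finite B" and orders: "\<And>p q. (p, q) \<in> S \<Longrightarrow>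
      m \<le> (if p \<in> A then a p else 0) + (if q \<in> B then b q else 0)"
  shows "(\<Prod>p\<in>A. xform p ^ a p) * (\<Prod>q\<in>B. yform q ^ b q) \<in> fat_ideal m S"
  unfolding fat_ideal_eq
proof clarify
  fix p q assume pq: "(p, q) \<in> S"
  define k l where "k = (if p \<in> A then a p else 0)" and "l = (if q \<in> B then b q else 0)"
  have "xform p ^ k dvd (\<Prod>p\<in>A. xform p ^ a p)" "yform q ^ l dvd (\<Prod>q\<in>B. yform q ^ b q)"
    using dvd_prodI[OF fin(1), of p "\<lambda>p. xform p ^ a p"] dvd_prodI[OF fin(2), of q "\<lambda>q. yform q ^ b q"]
    by (simp_all add: k_def l_def)
  then obtain r s where "(\<Prod>p\<in>A. xform p ^ a p) = xform p ^ k * r"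
    "(\<Prod>q\<in>B. yform q ^ b q) = yform q ^ l * s" by (elim dvdE)
  then have "(\<Prod>p\<in>A. xform p ^ a p) * (\<Prod>q\<in>B. yform q ^ b q) = xform p ^ k * yform q ^ l * (r * s)"
    by (simp add: ac_simps)
  moreover have "m \<le> k + l" using orders[OF pq] by (simp add: k_def l_def)
  ultimately show "(\<Prod>p\<in>A. xform p ^ a p) * (\<Prod>q\<in>B. yform q ^ b q)
      \<in> pair_pow {0} (xform (fst (p, q))) (yform (snd (p, q))) m"
    using ideal_mult_right[OF is_ideal_pair_pow pair_pow_monomial] by simp
qed

text \<open>Modulo \<open>xform c\<close>, all forms in \<open>x\<close> are proportional to \<open>xform d\<close>.\<close>
lemma xform_prod_power_mult_mem:
  assumes J: "is_ideal J" and c: "normal c" "xform c \<in> J"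
    and "finite A" "\<And>p. p \<in> A \<Longrightarrow> normal p" "c \<notin> A" "(\<Prod>p\<in>A. xform p ^ e p) * g \<in> J"
  shows "xform d ^ (\<Sum>p\<in>A. e p) * g \<in> J"
proof -
  have power: "xform d ^ n * g \<in> J" if "normal p" "p \<noteq> c" "xform p ^ n * g \<in> J" for p n g
    using that(3)
  proof (induction n arbitrary: g)
    case (Suc n)
    then have "xform p * (xform p ^ n * g) \<in> J" by (simp add: mult.assoc)
    then have "xform d * (xform p ^ n * g) \<in> J"
      by (rule lform_mult_mem[OF J that(1) c(1) that(2) _ ideal_mult_right[OF J c(2)]])
    then have "xform p ^ n * (xform d * g) \<in> J" by (simp add: ac_simps)
    from Suc.IH[OF this] show ?case by (simp add: ac_simps)
  qed simp
  show ?thesis using assms(4-)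
  proof (induction A arbitrary: g rule: finite_induct)
    case (insert p A)
    then have "xform p ^ e p * ((\<Prod>p\<in>A. xform p ^ e p) * g) \<in> J" by (simp add: mult.assoc)
    then have "xform d ^ e p * ((\<Prod>p\<in>A. xform p ^ e p) * g) \<in> J"
      using insert.prems by (intro power) auto
    then have "(\<Prod>p\<in>A. xform p ^ e p) * (xform d ^ e p * g) \<in> J" by (simp add: ac_simps)
    then have "xform d ^ (\<Sum>p\<in>A. e p) * (xform d ^ e p * g) \<in> J" using insert by simp
    then show ?case using insert.hyps by (simp add: power_add ac_simps)
  qed simp
qed

lemma has_socle_irrelevant_if_forms_kill:
  assumes J: "is_ideal J" "z \<notin> J"
    and A: "finite A" "\<And>p. p \<in> A \<Longrightarrow> normal p" "(\<Prod>p\<in>A. xform p ^ m) \<in> J"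
    and c: "normal c" "c \<notin> A" "xform c \<in> J"
    and B: "finite B" "\<And>q. q \<in> B \<Longrightarrow> normal q"
    and R: "R \<subseteq> B" "(\<Prod>q\<in>R. yform q ^ m) * z \<in> J"
      "\<And>q. q \<in> R \<Longrightarrow> (\<Prod>q\<in>B - {q}. yform q ^ m) * z \<in> J"
  shows "has_socle irrelevant_ideal J"
proof -
  obtain q r where q: "q \<in> R" "r * z \<notin> J" "yform q * (r * z) \<in> J"
    using killed_by_prod_power[OF finite_subset[OF R(1) B(1)] R(2) J(2)] by blast
  have row_kills: "(\<Prod>q\<in>B - {q}. yform q ^ m) * (r * z) \<in> J"
    using ideal_mult[OF J(1) R(3)[OF q(1)], of r] by (simp add: ac_simps)
  obtain q' s where q': "q' \<in> B - {q}" "s * (r * z) \<notin> J" "yform q' * (s * (r * z)) \<in> J"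
    using killed_by_prod_power[OF finite_Diff[OF B(1)] row_kills q(2)] by blast
  obtain p t where p: "p \<in> A" "t * (s * (r * z)) \<notin> J" "xform p * (t * (s * (r * z))) \<in> J"
    using killed_by_prod_power[OF A(1) ideal_mult_right[OF J(1) A(3)] q'(2)] by blast
  define w where "w = t * (s * (r * z))"
  have "yform q * w \<in> J" using ideal_mult[OF J(1) q(3), of "t * s"] by (simp add: w_def ac_simps)
  moreover have "yform q' * w \<in> J" using ideal_mult[OF J(1) q'(3), of t]
    by (simp add: w_def ac_simps)
  moreover have "xform p * w \<in> J" "w \<notin> J" using p by (simp_all add: w_def)
  moreover have "xform c * w \<in> J" by (rule ideal_mult_right[OF J(1) c(3)])
  moreover have "normal q" "normal q'" "q \<noteq> q'" using q(1) q'(1) R(1) B(2) by blast+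
  moreover have "normal p" "p \<noteq> c" using p(1) A(2) c(2) by blast+
  ultimately have "Var v * w \<in> J" for v
    using variables_mult_mem[OF J(1), of q q' Y0 Y1 w] variables_mult_mem[OF J(1), of p c X0 X1 w] c(1)
    by (cases v) simp_all
  then show ?thesis using \<open>w \<notin> J\<close> by (intro has_socle_irrelevantI[OF J(1)])
qed

context normal_points
begin

lemma full_rows_subset: "full_rows S \<subseteq> rows S"
  by (auto simp: full_rows_def)

lemma finite_full_rows: "finite (full_rows S)"
  using full_rows_subset finite_rows by (rule finite_subset)

lemma normal_full_row: "q \<in> full_rows S \<Longrightarrow> normal q"
  using full_rows_subset normal_row by blast

lemma full_row_dvd:
  assumes f: "f \<in> fat_ideal m S" "bihomogeneous a b f" and a: "a < m * card (columns S)"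
    and q: "q \<in> full_rows S"
  shows "yform q dvd f"
proof (rule bihomogeneous_dvd_of_mem_adjoin[OF f(2) bihomogeneous_yform])
  have "columns S \<times> {q} \<subseteq> S" using q by (auto simp: full_rows_def)
  then have "f \<in> pair_pow {0} (\<Prod>p\<in>columns S. xform p) (yform q) m"
    using f(1) fat_ideal_mono fat_ideal_row[OF finite_columns normal_column normal_full_row[OF q]]
    by blast
  then show "f \<in> adjoin (adjoin {0} (yform q)) ((\<Prod>p\<in>columns S. xform p) ^ m)"
    using pair_pow_subset_adjoin unfolding pair_pow_commute[of _ _ "yform q"] by blast
  show "bihomogeneous (m * card (columns S)) (m * 0) ((\<Prod>p\<in>columns S. xform p) ^ m)"
    by (rule bihomogeneous_power[OF bihomogeneous_xform_prod])
qed (use a in simp)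

lemma regular_mod_pair_pow_yform_prod:
  assumes "(p, q) \<in> S" "B \<subseteq> rows S" "q \<notin> B"
  shows "regular_mod (pair_pow {0} (yform q) (xform p) n) (\<Prod>q\<in>B. yform q)"
proof (rule regular_mod_pair_pow[OF is_ideal_zero])
  have normals: "normal p" "normal q" using normal_fst[OF assms(1)] normal_snd[OF assms(1)] by simp_all
  then show "regular_mod {0} (yform q)" "regular_mod (adjoin {0} (yform q)) (xform p)"
    by (rule regular_mod_yform_xform)+
  have "regular_mod (adjoin (adjoin {0} (yform q)) (xform p)) (yform r)" if "r \<in> B" for r
  proof -
    have "normal r" "r \<noteq> q" using that assms(2,3) normal_row by blast+
    then show ?thesis
      using normals
      by (simp add: adjoin_linear_ideal regular_mod_lform flip: linear_ideal_Plane_eq_zero)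
  qed
  then show "regular_mod (adjoin (adjoin {0} (yform q)) (xform p)) (\<Prod>q\<in>B. yform q)"
    by (rule regular_mod_prod)
qed

lemma cofactor_mem_pair_pow:
  assumes f: "(\<Prod>q\<in>full_rows S. yform q) * g \<in> fat_ideal m S" and m: "m > 0" and p: "p \<in> columns S"
  shows "\<exists>q. g \<in> pair_pow {0} (yform q) (xform p) (column_order m S p)"
proof -
  have mem: "(\<Prod>q\<in>full_rows S. yform q) * g \<in> pair_pow {0} (yform q) (xform p) m" if "(p, q) \<in> S" for q
    using f that by (auto simp: fat_ideal_eq pair_pow_commute[of _ "yform q"])
  show ?thesis
  proof (cases "\<forall>q. (p, q) \<in> S \<longrightarrow> q \<in> full_rows S")
    case True
    obtain q where q: "(p, q) \<in> S" using p by auto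
    have normals: "normal p" "normal q" using normal_fst[OF q] normal_snd[OF q] by simp_all
    have "(\<Prod>q\<in>full_rows S. yform q) = yform q * (\<Prod>q\<in>full_rows S - {q}. yform q)"
      using True q by (intro prod.remove finite_full_rows) blast
    then have mem_others: "(\<Prod>q\<in>full_rows S - {q}. yform q) * (yform q * g)
        \<in> pair_pow {0} (yform q) (xform p) m"
      using mem[OF q] by (simp add: ac_simps)
    have "full_rows S - {q} \<subseteq> rows S" "q \<notin> full_rows S - {q}" using full_rows_subset by blast+
    then have "yform q * g \<in> pair_pow {0} (yform q) (xform p) m"
      by (rule regular_modD[OF regular_mod_pair_pow_yform_prod[OF q] mem_others])
    then have "yform q * g \<in> pair_pow {0} (yform q) (xform p) (Suc (m - 1))" using m by simp
    then have "g \<in> pair_pow {0} (yform q) (xform p) (m - 1)"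
      by (rule pair_pow_cancel[OF is_ideal_zero regular_mod_yform_xform[OF normals]])
    moreover have "column_order m S p = m - 1" using True by (simp add: column_order_def)
    ultimately show ?thesis by metis
  next
    case False
    then obtain q where q: "(p, q) \<in> S" "q \<notin> full_rows S" by blast
    have "g \<in> pair_pow {0} (yform q) (xform p) m"
      using mem[OF q(1)]
      by (rule regular_modD[OF regular_mod_pair_pow_yform_prod[OF q(1) full_rows_subset q(2)]])
    moreover have "column_order m S p = m"
      unfolding column_order_def by (rule if_not_P[OF False])
    ultimately show ?thesis by metis
  qed
qed

text \<open>A form of this bidegree in the ideal is divisible by the equation of every full row, for lack
  of degree in \<open>x\<close>; the cofactor depends on \<open>x\<close> only and must vanish to the order \<open>column_order\<close>
  on every column.\<close>
lemma fat_ideal_small_degree_zero: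
  assumes f: "f \<in> fat_ideal m S" and m: "m > 0"
    and hom: "bihomogeneous i (card (full_rows S)) f" and i: "i < cofactor_degree m S"
  shows "f = 0"
proof -
  have "i < m * card (columns S)" using i cofactor_degree_le[of m S] by simp
  then have rows_dvd: "(\<Prod>q\<in>full_rows S. yform q) dvd f"
    using lform_prod_power_dvd[of Y0 Y1 "full_rows S" "\<lambda>_. 1"] full_row_dvd[OF f hom]
      finite_full_rows normal_full_row by simp
  obtain g where g: "bihomogeneous i 0 g" "f = (\<Prod>q\<in>full_rows S. yform q) * g"
    using bihomogeneous_cofactor[OF hom bihomogeneous_yform_prod rows_dvd] by auto
  have "xform p ^ column_order m S p dvd g" if p: "p \<in> columns S" for p
  proof -
    obtain q where "g \<in> pair_pow {0} (yform q) (xform p) (column_order m S p)"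
      using cofactor_mem_pair_pow[OF _ m p] f g(2) by blast
    then have "g \<in> adjoin (adjoin {0} (yform q)) (xform p ^ column_order m S p)"
      using pair_pow_subset_adjoin by blast
    then have "g \<in> adjoin (adjoin {0} (xform p ^ column_order m S p)) (yform q)"
      by (subst adjoin_commute)
    then show ?thesis
      by (rule bihomogeneous_dvd_of_mem_adjoin[OF g(1) bihomogeneous_xform_power bihomogeneous_yform]) simp
  qed
  then have "(\<Prod>p\<in>columns S. xform p ^ column_order m S p) dvd g"
    by (intro lform_prod_power_dvd finite_columns normal_column) simp_all
  moreover have "\<not> (cofactor_degree m S \<le> i \<and> 0 \<le> (0::nat))" using i by simp
  ultimately have "g = 0"
    unfolding cofactor_degree_def
    by (rule bihomogeneous_eq_0[OF g(1) bihomogeneous_xform_prod_power])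
  then show ?thesis using g(2) by simp
qed

lemma socle_witness_notin:
  assumes m: "m > 0" and i: "i < cofactor_degree m S" and cd: "normal c" "normal d" "c \<noteq> d"
  shows "xform d ^ i * (\<Prod>q\<in>full_rows S. yform q) \<notin> adjoin (fat_ideal m S) (xform c)"
    (is "?z \<notin> _")
proof
  let ?b = "card (full_rows S)"
  assume "?z \<in> adjoin (fat_ideal m S) (xform c)"
  then obtain h where h: "?z - xform c * h \<in> fat_ideal m S"
    using mem_adjoin_iff[OF is_ideal_fat_ideal] by blast
  have "bihomogeneous i ?b ?z"
    using bihomogeneous_mult[OF bihomogeneous_xform_power bihomogeneous_yform_prod] by simp
  then have "component i ?b (?z - xform c * h) = ?z - component i ?b (xform c * h)"
    by (simp add: component_diff component_bihomogeneous)
  moreover have "component i ?b (?z - xform c * h) = 0"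
    using h graded_fat_ideal[of m S] m i
    by (intro fat_ideal_small_degree_zero[OF _ _ bihomogeneous_component]) (auto simp: graded_ideal_def)
  ultimately have "xform c dvd ?z" using dvd_component[OF bihomogeneous_xform, of c "xform c * h"] by simp
  then have "?z \<in> adjoin (linear_ideal Plane Plane) (xform c)"
    by (simp add: linear_ideal_Plane_eq_zero mem_adjoin_zero_iff)
  then have "?z \<in> linear_ideal (Line c) Plane" using cd by (simp add: adjoin_linear_ideal)
  moreover have prime: "prime_ideal (linear_ideal (Line c) Plane)" using cd
    by (simp add: prime_linear_ideal)
  ultimately consider (column) "xform d ^ i \<in> linear_ideal (Line c) Plane"
    | (rows) "(\<Prod>q\<in>full_rows S. yform q) \<in> linear_ideal (Line c) Plane"
    unfolding prime_ideal_def by blast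
  then show False
  proof cases
    case column
    then have "xform d \<in> linear_ideal (Line c) Plane" by (rule prime_ideal_power[OF prime])
    then show False using cd by (simp add: lform_mem_linear_ideal_iff)
  next
    case rows
    then obtain q where "q \<in> full_rows S" "yform q \<in> linear_ideal (Line c) Plane"
      using prime_ideal_prod[OF prime finite_full_rows] by blast
    then show False using cd normal_full_row by (simp add: lform_mem_linear_ideal_iff)
  qed
qed

lemma xform_power_mult_mem:
  assumes J: "is_ideal J" and c: "normal c" "c \<notin> columns S" "xform c \<in> J"
    and C: "C \<subseteq> columns S" "(\<Sum>p\<in>C. a p) \<le> i"
    and mem: "(\<Prod>p\<in>C. xform p ^ a p) * g \<in> J"
  shows "xform d ^ i * g \<in> J"
proof -
  have "finite C" "\<And>p. p \<in> C \<Longrightarrow> normal p" "c \<notin> C"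
    using C(1) c(2) finite_columns finite_subset normal_column by blast+
  then have "xform d ^ (\<Sum>p\<in>C. a p) * g \<in> J"
    by (rule xform_prod_power_mult_mem[OF J c(1,3) _ _ _ mem])
  then have "xform d ^ (i - (\<Sum>p\<in>C. a p)) * (xform d ^ (\<Sum>p\<in>C. a p) * g) \<in> J"
    by (rule ideal_mult[OF J])
  then show ?thesis using C(2) by (simp flip: mult.assoc power_add)
qed

lemma nonfull_rows_kill_socle_witness:
  assumes J: "is_ideal J" "fat_ideal m S \<subseteq> J" and c: "normal c" "c \<notin> columns S" "xform c \<in> J"
    and m: "m > 0" and i: "(\<Sum>p\<in>columns S. m - 1) \<le> i"
  shows "(\<Prod>q\<in>rows S - full_rows S. yform q ^ m) * (xform d ^ i * (\<Prod>q\<in>full_rows S. yform q)) \<in> J"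
proof -
  define b where "b q = (if q \<in> full_rows S then 1 else m)" for q
  have "(\<Prod>q\<in>rows S. yform q ^ b q) =
      (\<Prod>q\<in>rows S - full_rows S. yform q ^ b q) * (\<Prod>q\<in>full_rows S. yform q ^ b q)"
    by (rule prod.subset_diff[OF full_rows_subset finite_rows])
  also have "\<dots> = (\<Prod>q\<in>rows S - full_rows S. yform q ^ m) * (\<Prod>q\<in>full_rows S. yform q)"
    by (intro arg_cong2[where f = "(*)"] prod.cong) (simp_all add: b_def)
  finally have rows: "(\<Prod>q\<in>rows S. yform q ^ b q) = \<dots>" .
  have "m \<le> m - 1 + b q" for q using m by (cases m) (simp_all add: b_def)
  moreover have "p \<in> columns S" "q \<in> rows S" if "(p, q) \<in> S" for p q using that by force+
  ultimately have "(\<Prod>p\<in>columns S. xform p ^ (m - 1)) * (\<Prod>q\<in>rows S. yform q ^ b q) \<in> fat_ideal m S"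
    by (intro forms_prod_mem_fat_ideal finite_columns finite_rows) simp
  then have "xform d ^ i * (\<Prod>q\<in>rows S. yform q ^ b q) \<in> J"
    using J(2) by (intro xform_power_mult_mem[OF J(1) c order_refl i]) blast
  then show ?thesis by (simp only: rows ac_simps)
qed

lemma other_rows_kill_socle_witness:
  assumes J: "is_ideal J" "fat_ideal m S \<subseteq> J" and c: "normal c" "c \<notin> columns S" "xform c \<in> J"
    and q: "(\<Sum>p | (p, q) \<in> S. m) \<le> i"
  shows "(\<Prod>r\<in>rows S - {q}. yform r ^ m) * (xform d ^ i * K) \<in> J"
proof -
  have sub: "{p. (p, q) \<in> S} \<subseteq> columns S" by force
  have "p \<in> columns S" "r \<in> rows S" if "(p, r) \<in> S" for p r using that by force+
  then have "(\<Prod>p | (p, q) \<in> S. xform p ^ m) * (\<Prod>r\<in>rows S - {q}. yform r ^ m) \<in> fat_ideal m S"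
    using finite_subset[OF sub finite_columns] finite_rows
    by (intro forms_prod_mem_fat_ideal) auto
  then have "xform d ^ i * (\<Prod>r\<in>rows S - {q}. yform r ^ m) \<in> J"
    using J(2) by (intro xform_power_mult_mem[OF J(1) c sub q]) blast
  then have "xform d ^ i * (\<Prod>r\<in>rows S - {q}. yform r ^ m) * K \<in> J"
    by (rule ideal_mult_right[OF J(1)])
  then show ?thesis by (simp only: ac_simps)
qed

lemma depth_fat_ideal_not_grid:
  assumes inf: "infinite (UNIV :: 'k set)" and m: "m \<ge> 2" and "\<not> grid S"
  shows "depth_quot (fat_ideal m S) \<le> 1"
proof -
  obtain c where c: "normal c" "c \<notin> columns S" using ex_normal_avoiding[OF inf finite_columns] .
  obtain d where d: "normal d" "d \<noteq> c" using ex_normal_neq by blast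
  define J where "J = adjoin (fat_ideal m S) (xform c)"
  have J: "is_ideal J" "fat_ideal m S \<subseteq> J" and cJ: "xform c \<in> J"
    by (simp_all add: J_def is_ideal_adjoin adjoin_superset adjoin_self)
  define i where "i = cofactor_degree m S - 1"
  note degree = cofactor_degree_not_grid[OF finite_points m \<open>\<not> grid S\<close>]
  have "has_socle irrelevant_ideal J"
  proof (rule has_socle_irrelevant_if_forms_kill[OF J(1) _ finite_columns normal_column _ c cJ
        finite_rows normal_row Diff_subset])
    show "xform d ^ i * (\<Prod>q\<in>full_rows S. yform q) \<notin> J"
      unfolding J_def using m degree(1) c(1) d by (intro socle_witness_notin) (auto simp: i_def)
    have "p \<in> columns S" if "(p, q) \<in> S" for p q using that by force
    then show "(\<Prod>p\<in>columns S. xform p ^ m) \<in> J"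
      using forms_prod_mem_fat_ideal[OF finite_columns finite.emptyI, of S m "\<lambda>_. m" "\<lambda>_. 0"] J(2) by auto
    show "(\<Prod>q\<in>rows S - full_rows S. yform q ^ m) * (xform d ^ i * (\<Prod>q\<in>full_rows S. yform q)) \<in> J"
      using m degree(1) by (intro nonfull_rows_kill_socle_witness[OF J c cJ]) (auto simp: i_def)
    show "(\<Prod>r\<in>rows S - {q}. yform r ^ m) * (xform d ^ i * (\<Prod>q\<in>full_rows S. yform q)) \<in> J"
      if "q \<in> rows S - full_rows S" for q
      using degree(2)[OF that]
      by (intro other_rows_kill_socle_witness[OF J c cJ]) (auto simp: i_def)
  qed
  then show ?thesis
    unfolding J_def
    by (rule depth_quot_le_one[OF is_ideal_fat_ideal regular_mod_fat_ideal_xform[OF c]])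
qed

lemma ACM_fat_ideal_iff_complete_intersection:
  assumes inf: "infinite (UNIV :: 'k set)" and "m \<ge> 2" "S \<noteq> {}"
  shows "ACM_ideal (fat_ideal m S) \<longleftrightarrow> complete_intersection S"
proof -
  have "krull_dim_quot (fat_ideal m S) = 2" using assms by (intro krull_dim_fat_ideal) auto
  moreover have "depth_quot (fat_ideal m S) = 2 \<longleftrightarrow> grid S"
  proof
    assume "depth_quot (fat_ideal m S) = 2"
    moreover have "\<not> (2 :: enat) \<le> 1" by simp
    ultimately show "grid S" using depth_fat_ideal_not_grid[OF inf assms(2)] by metis
  qed (use assms in \<open>auto intro: depth_fat_ideal_grid\<close>)
  ultimately show ?thesis by (simp add: ACM_ideal_def complete_intersection_iff_grid)
qed

end

section \<open>Normalising coordinates\<close>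

lemma infinite_alg_closed_field: "infinite (UNIV :: 'k::alg_closed_field set)"
proof
  assume fin: "finite (UNIV :: 'k set)"
  define p :: "'k poly" where "p = (\<Prod>a\<in>UNIV. [:- a, 1:])"
  have "degree p = card (UNIV :: 'k set)"
    unfolding p_def by (subst degree_prod_eq_sum_degree) auto
  then have "degree (p + 1) > 0"
    using fin finite_UNIV_card_ge_0[OF fin] by (subst degree_add_eq_left) auto
  then obtain x where "poly (p + 1) x = 0" using alg_closed_imp_poly_has_root by blast
  moreover have "poly p x = 0" using fin by (auto simp: p_def poly_prod)
  ultimately show False by simp
qed

definition normalize_pair :: "'k::field \<times> 'k \<Rightarrow> 'k \<times> 'k" where
  "normalize_pair p = (if snd p = 0 then (1, 0) else (fst p / snd p, 1))"

lemma normal_normalize_pair: "normal (normalize_pair p)"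
  by (simp add: normal_def normalize_pair_def)

lemma lform_normalize_pair:
  assumes "p \<noteq> (0, 0)"
  obtains a where "a \<noteq> 0" "lform u v p = Const a * lform u v (normalize_pair p)"
proof
  define a where "a = (if snd p = 0 then fst p else snd p)"
  show "a \<noteq> 0" using assms by (auto simp: a_def prod_eq_iff)
  have "fst p = a * fst (normalize_pair p)" "snd p = a * snd (normalize_pair p)"
    by (simp_all add: a_def normalize_pair_def)
  then show "lform u v p = Const a * lform u v (normalize_pair p)"
    by (simp add: lform_def Const_simps right_diff_distrib mult.assoc)
qed

definition normalize_point :: "'k::field point \<Rightarrow> 'k point" where
  "normalize_point P = (normalize_pair (fst P), normalize_pair (snd P))"

lemma lform_mem_iff_normalize_pair:
  assumes "is_ideal J" "p \<noteq> (0, 0)"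
  shows "lform u v p \<in> J \<longleftrightarrow> lform u v (normalize_pair p) \<in> J"
proof -
  obtain a where a: "a \<noteq> 0" "lform u v p = Const a * lform u v (normalize_pair p)"
    using lform_normalize_pair[OF assms(2)] .
  then have "lform u v (normalize_pair p) = Const (inverse a) * lform u v p"
    by (simp add: Const_inverse_mult_cancel)
  then show ?thesis using a(2) ideal_mult[OF assms(1)] by metis
qed

lemma point_ideal_normalize_point:
  assumes "valid_point P" shows "point_ideal (normalize_point P) = point_ideal P"
proof -
  let ?p = "normalize_pair (fst P)" and ?q = "normalize_pair (snd P)"
  have neq: "fst P \<noteq> (0, 0)" "snd P \<noteq> (0, 0)" using assms by (simp_all add: valid_point_def)
  note mem_iff = lform_mem_iff_normalize_pair[OF is_ideal_ideal_gen]
  have "xform (fst P) \<in> ideal_gen {xform ?p, yform ?q}" "yform (snd P) \<in> ideal_gen {xform ?p, yform ?q}"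
    by (simp_all add: mem_iff neq ideal_gen_base)
  moreover have "xform ?p \<in> ideal_gen {xform (fst P), yform (snd P)}"
    "yform ?q \<in> ideal_gen {xform (fst P), yform (snd P)}"
    using mem_iff[OF neq(1)] mem_iff[OF neq(2)] by (blast intro: ideal_gen_base)+
  ultimately have "ideal_gen {xform ?p, yform ?q} = ideal_gen {xform (fst P), yform (snd P)}"
    unfolding ideal_gen_eq_iff by simp
  then show ?thesis
    by (simp add: normalize_point_def point_ideal_eq_ideal_gen)
qed

theorem theorem5p4:
  fixes m :: nat and S :: "('k::alg_closed_field) point set"
  assumes "m \<ge> 2" and "finite S" and "S \<noteq> {}" and "\<forall>P\<in>S. valid_point P"
  shows "ACM_ideal (fat_ideal m S) \<longleftrightarrow> complete_intersection S"
proof -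
  define T where "T = normalize_point ` S"
  interpret normal_points T
    using assms(2) by unfold_locales (auto simp: T_def normalize_point_def normal_normalize_pair)
  have "fat_ideal m T = fat_ideal m S" "points_ideal T = points_ideal S"
    using assms(4)
    by (simp_all add: fat_ideal_def points_ideal_def T_def point_ideal_normalize_point)
  moreover have "ACM_ideal (fat_ideal m T) \<longleftrightarrow> complete_intersection T"
    using assms(1,3) infinite_alg_closed_field
    by (intro ACM_fat_ideal_iff_complete_intersection) (simp_all add: T_def)
  ultimately show ?thesis by (simp add: complete_intersection_def)
qed

end
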